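(* Let $t\ge d\ge2$ be integers and let $(\gamma_t,w_t)$ be a weighted Marcinkiewicz–Zygmund curve of order $t$ on $\mathbb S^d$ with constants $0<a\le A$. Then its length satisfies \[ \ell(\gamma_t)\ge \frac{\dim\Pi_t}{t}\,\frac{\sqrt{d+2}}{4}\Big(\frac aA\Big)^{1+\frac1{2t}} . \]
   Context: $\mathbb S^d\subset\mathbb R^{d+1}$ is the unit sphere with normalized surface measure (total mass $1$), and $L^2$ norms are with respect to it. $\Pi_t$ is the space of restrictions to $\mathbb S^d$ of polynomials in $d+1$ variables of degree at most $t$, $\dim\Pi_t=\binom{d+t}{t}+\binom{d+t-1}{t-1}$. A curve is a continuous, piecewise smooth, closed map $\gamma:[0,L]\to\mathbb S^d$ ($\gamma(0)=\gamma(L)$) parametrized by arc length ($\|\dot\gamma\|=1$ a.e.), so its length is $\ell(\gamma)=L$ and $\int_\gamma g:=\int_0^L g(\gamma(u))\,du$. A weighted Marcinkiewicz–Zygmund curve of order $t$ is a pair $(\gamma_t,w_t)$ of such a curve and a nonnegative weight $w_t$ defined and integrable on the trajectory of $\gamma_t$ such that for all $f\in\Pi_t$, \[ a\|f\|_{L^2(\mathbb S^d)}^2\le\frac1{\ell(\gamma_t)}\int_{\gamma_t}|f|^2w_t\le A\|f\|_{L^2(\mathbb S^d)}^2 . \] *)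

theory Defs
  imports "HOL-Analysis.Analysis"
begin

text \<open>The ambient space R^(d+1) is an arbitrary euclidean space 'a, d = DIM('a) - 1.
  The unit sphere S^d is sphere 0 1.\<close>

text \<open>Normalized surface measure on the unit sphere, realised as the cone measure:
  push forward of the uniform (probability) measure on the unit ball under radial
  projection x |-> x / |x|. This is the rotation invariant probability measure on the
  sphere, i.e. the normalized surface measure.\<close>
definition sphere_measure :: "'a::euclidean_space measure" where
  "sphere_measure = distr (uniform_measure lborel (ball 0 1)) borel (\<lambda>x. x /\<^sub>R norm x)"

definition sphere_L2sq :: "('a::euclidean_space \<Rightarrow> real) \<Rightarrow> real" where
  "sphere_L2sq f = integral\<^sup>L sphere_measure (\<lambda>x. (f x)\<^sup>2)"

definition multi_indices :: "nat \<Rightarrow> ('a::euclidean_space \<Rightarrow> nat) set" where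
  "multi_indices t = {\<alpha>. (\<forall>i. i \<notin> Basis \<longrightarrow> \<alpha> i = 0) \<and> (\<Sum>i\<in>Basis. \<alpha> i) \<le> t}"

text \<open>f is (the function of) a real polynomial in the d+1 coordinates of degree at most t.
  Pi_t consists of the restrictions of such functions to the sphere.\<close>
definition poly_deg_le :: "nat \<Rightarrow> ('a::euclidean_space \<Rightarrow> real) \<Rightarrow> bool" where
  "poly_deg_le t f \<longleftrightarrow> (\<exists>c :: ('a \<Rightarrow> nat) \<Rightarrow> real.
      f = (\<lambda>x. \<Sum>\<alpha>\<in>multi_indices t. c \<alpha> * (\<Prod>i\<in>Basis. (x \<bullet> i) ^ (\<alpha> i))))"

definition dim_Pi :: "'a::euclidean_space itself \<Rightarrow> nat \<Rightarrow> nat" where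
  "dim_Pi _ t = (let d = DIM('a) - 1 in ((d + t) choose t) + ((d + t - 1) choose (t - 1)))"

definition arclength_sphere_curve :: "(real \<Rightarrow> 'a::euclidean_space) \<Rightarrow> real \<Rightarrow> bool" where
  "arclength_sphere_curve \<gamma> L \<longleftrightarrow>
     0 < L \<and> continuous_on {0..L} \<gamma> \<and> \<gamma> piecewise_C1_differentiable_on {0..L} \<and>
     \<gamma> 0 = \<gamma> L \<and> (\<forall>u\<in>{0..L}. \<gamma> u \<in> sphere 0 1) \<and>
     (AE u in lborel. u \<in> {0..L} \<longrightarrow> norm (vector_derivative \<gamma> (at u)) = 1)"

definition weighted_MZ_curve ::
  "nat \<Rightarrow> real \<Rightarrow> real \<Rightarrow> (real \<Rightarrow> 'a::euclidean_space) \<Rightarrow> real \<Rightarrow> ('a \<Rightarrow> real) \<Rightarrow> bool" where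
  "weighted_MZ_curve t a A \<gamma> L w \<longleftrightarrow>
     arclength_sphere_curve \<gamma> L \<and>
     (\<forall>u\<in>{0..L}. 0 \<le> w (\<gamma> u)) \<and> (\<lambda>u. w (\<gamma> u)) integrable_on {0..L} \<and>
     (\<forall>f. poly_deg_le t f \<longrightarrow>
        a * sphere_L2sq f \<le> integral {0..L} (\<lambda>u. (f (\<gamma> u))\<^sup>2 * w (\<gamma> u)) / L \<and>
        integral {0..L} (\<lambda>u. (f (\<gamma> u))\<^sup>2 * w (\<gamma> u)) / L \<le> A * sphere_L2sq f)"

end

theory Submission
  imports Defs
begin

text \<open>Let \<open>(b\<^sub>\<alpha>)\<close> be an orthonormal basis of \<open>\<Pi>\<^sub>t\<close> and \<open>N\<close> its size. By rotation invariance \<open>\<Sum> b\<^sub>\<alpha>\<^sup>2 = N\<close> on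
  the sphere, and \<open>\<Sum> (\<partial>\<^sub>v b\<^sub>\<alpha>)\<^sup>2 = \<kappa> |v|\<^sup>2\<close> for tangent vectors \<open>v\<close> with a constant \<open>\<kappa>\<close>. Differentiating the
  first identity twice shows that \<open>d \<kappa>\<close> is minus the trace of the Laplace--Beltrami operator on \<open>\<Pi>\<^sub>t\<close>,
  so \<open>\<kappa> = N t (t + d) / (d + 2)\<close>; hence \<open>u \<mapsto> (b\<^sub>\<alpha> (\<gamma> u))\<^sub>\<alpha>\<close> is Lipschitz with constant \<open>\<surd>\<kappa>\<close>.
  Cut the curve into \<open>n\<close> arcs of equal length and let \<open>V\<close> be the space of polynomials in \<open>\<Pi>\<^sub>t\<close> vanishing at the
  midpoints. Taking the trace over \<open>V\<close> of the Marcinkiewicz--Zygmund inequality gives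
  \<open>a (N - n) \<le> A \<kappa> (L / 2n)\<^sup>2\<close>. With \<open>n = \<lfloor>N / 2\<rfloor>\<close> and \<open>d \<le> t\<close> this yields the claim, even with the
  exponent \<open>1/2\<close> of \<open>a / A\<close>.\<close>

section \<open>Polynomial functions\<close>

text \<open>Why a trace: a single polynomial of norm 1 in \<open>V\<close> would have
  \<open>a\<close> in place of \<open>a (N - n)\<close> on the left against the same right side, and
  since \<open>\<kappa>\<close> is proportional to \<open>N\<close> the bound for the length would
  lose a factor of order \<open>sqrt N\<close>. Summed over an orthonormal basis of
  \<open>V\<close>, the squares at a point of the curve are the squared length of a projection that
  kills the embedded midpoints, so the Lipschitz bound for the whole embedding is paid only once.
  The weight then enters only through its mean, which the constant polynomial 1 bounds by
  \<open>A\<close>. The trace of the Laplace--Beltrami operator is read off a triangular matrix: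
  modulo lower degree it acts on degree \<open>s\<close> as a scalar, so the orthonormal basis has
  to respect the degree. It is obtained from monomials with exponent at most 1 in one fixed
  coordinate. Invariance is used through reflections in hyperplanes; two of them move any unit
  tangent vector to any other. The constant 4: \<open>n = N / 2\<close> with
  \<open>t + d \<le> 2 * t\<close> would give \<open>sqrt (d + 2) / 2\<close>, and rounding
  \<open>n\<close> down costs at most a factor 2 because
  \<open>2 * n \<ge> N - 1 \<ge> N / 2\<close>.\<close>

definition mfun :: "('a::euclidean_space \<Rightarrow> nat) \<Rightarrow> 'a \<Rightarrow> real" where
  "mfun \<alpha> x = (\<Prod>i\<in>Basis. (x \<bullet> i) ^ \<alpha> i)"

lemma poly_deg_le_mfun:
  "poly_deg_le t f \<longleftrightarrow> (\<exists>c. f = (\<lambda>x. \<Sum>\<alpha>\<in>multi_indices t. c \<alpha> * mfun \<alpha> x))"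
  by (simp add: poly_deg_le_def mfun_def)

lemma finite_multi_indices: "finite (multi_indices t :: ('a::euclidean_space \<Rightarrow> nat) set)"
proof (rule finite_subset)
  show "multi_indices t \<subseteq> {f. \<forall>x. (x \<in> (Basis::'a set) \<longrightarrow> f x \<in> {..t}) \<and> (x \<notin> Basis \<longrightarrow> f x = 0)}"
  proof safe
    fix \<alpha> :: "'a \<Rightarrow> nat" and i :: 'a assume "\<alpha> \<in> multi_indices t" "i \<in> Basis"
    then show "\<alpha> i \<le> t"
      using member_le_sum[of i Basis \<alpha>] by (auto simp: multi_indices_def)
  qed (auto simp: multi_indices_def)
  show "finite {f. \<forall>x. (x \<in> (Basis::'a set) \<longrightarrow> f x \<in> {..t}) \<and> (x \<notin> Basis \<longrightarrow> f x = (0::nat))}"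
    by (rule finite_set_of_finite_funs) auto
qed

lemma multi_indices_mono: "s \<le> t \<Longrightarrow> multi_indices s \<subseteq> multi_indices t"
  by (auto simp: multi_indices_def)

lemma poly_deg_le_zero: "poly_deg_le t (\<lambda>x. 0)"
  unfolding poly_deg_le_mfun by (rule exI[of _ "\<lambda>_. 0"]) auto

lemma poly_deg_le_add:
  assumes "poly_deg_le t f" "poly_deg_le t g" shows "poly_deg_le t (\<lambda>x. f x + g x)"
proof -
  obtain c d where "f = (\<lambda>x. \<Sum>\<alpha>\<in>multi_indices t. c \<alpha> * mfun \<alpha> x)"
      "g = (\<lambda>x. \<Sum>\<alpha>\<in>multi_indices t. d \<alpha> * mfun \<alpha> x)"
    using assms by (auto simp: poly_deg_le_mfun)
  then show ?thesis
    unfolding poly_deg_le_mfun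
    by (intro exI[of _ "\<lambda>\<alpha>. c \<alpha> + d \<alpha>"]) (auto simp: sum.distrib algebra_simps)
qed

lemma poly_deg_le_cmult:
  assumes "poly_deg_le t f" shows "poly_deg_le t (\<lambda>x. c * f x)"
proof -
  obtain d where "f = (\<lambda>x. \<Sum>\<alpha>\<in>multi_indices t. d \<alpha> * mfun \<alpha> x)"
    using assms by (auto simp: poly_deg_le_mfun)
  then show ?thesis
    unfolding poly_deg_le_mfun
    by (intro exI[of _ "\<lambda>\<alpha>. c * d \<alpha>"]) (auto simp: sum_distrib_left algebra_simps)
qed

lemma poly_deg_le_diff:
  assumes "poly_deg_le t f" "poly_deg_le t g" shows "poly_deg_le t (\<lambda>x. f x - g x)"
  using poly_deg_le_add[OF assms(1) poly_deg_le_cmult[OF assms(2), of "-1"]] by simp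

lemma poly_deg_le_sum:
  assumes "\<And>i. i \<in> I \<Longrightarrow> poly_deg_le t (f i)" shows "poly_deg_le t (\<lambda>x. \<Sum>i\<in>I. f i x)"
  using assms
  by (induction I rule: infinite_finite_induct) (auto intro: poly_deg_le_zero poly_deg_le_add)

lemma poly_deg_le_mfun_I: "\<alpha> \<in> multi_indices t \<Longrightarrow> poly_deg_le t (mfun \<alpha>)"
  unfolding poly_deg_le_mfun
  by (intro exI[of _ "\<lambda>\<beta>. if \<beta> = \<alpha> then 1 else 0"])
     (auto simp: if_distrib[of "\<lambda>c. c * _"] finite_multi_indices cong: if_cong)

text \<open>Reduces claims that are linear in the polynomial to monomials. The degree hypotheses in
  the cases \<open>add\<close> and \<open>scale\<close> supply the differentiability that the
  derivative rules ask for.\<close>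

lemma poly_deg_le_induct [consumes 1, case_names mono zero add scale]:
  assumes "poly_deg_le t f"
    and "\<And>\<alpha>. \<alpha> \<in> multi_indices t \<Longrightarrow> Q (mfun \<alpha>)"
    and zero: "Q (\<lambda>x. 0)"
    and add: "\<And>f g. poly_deg_le t f \<Longrightarrow> poly_deg_le t g \<Longrightarrow> Q f \<Longrightarrow> Q g \<Longrightarrow> Q (\<lambda>x. f x + g x)"
    and scale: "\<And>c f. poly_deg_le t f \<Longrightarrow> Q f \<Longrightarrow> Q (\<lambda>x. c * f x)"
  shows "Q f"
proof -
  obtain c where f: "f = (\<lambda>x. \<Sum>\<alpha>\<in>multi_indices t. c \<alpha> * mfun \<alpha> x)"
    using assms by (auto simp: poly_deg_le_mfun)
  have "Q (\<lambda>x. \<Sum>\<alpha>\<in>S. c \<alpha> * mfun \<alpha> x)" if "S \<subseteq> multi_indices t" for S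
    using finite_subset[OF that finite_multi_indices] that
  proof (induction S)
    case empty
    then show ?case using zero by simp
  next
    case (insert \<alpha> S)
    then show ?case
      by (auto intro!: add scale poly_deg_le_sum poly_deg_le_cmult assms(2) poly_deg_le_mfun_I)
  qed
  then show ?thesis unfolding f by blast
qed

lemma poly_deg_le_mono:
  assumes "poly_deg_le s f" "s \<le> t" shows "poly_deg_le t f"
  using assms(1)
  by (induction rule: poly_deg_le_induct)
     (use assms(2) multi_indices_mono in \<open>blast intro: poly_deg_le_mfun_I poly_deg_le_zero poly_deg_le_add poly_deg_le_cmult\<close>)+

lemma mfun_mult: "mfun \<alpha> x * mfun \<beta> x = mfun (\<lambda>i. \<alpha> i + \<beta> i) x"
  by (simp add: mfun_def power_add prod.distrib)

lemma poly_deg_le_mult: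
  assumes "poly_deg_le s f" "poly_deg_le t g" shows "poly_deg_le (s + t) (\<lambda>x. f x * g x)"
  using assms(1)
proof (induction rule: poly_deg_le_induct)
  case (mono \<alpha>)
  show ?case using assms(2)
  proof (induction rule: poly_deg_le_induct)
    case (mono \<beta>)
    with \<open>\<alpha> \<in> multi_indices s\<close> have "(\<lambda>i. \<alpha> i + \<beta> i) \<in> multi_indices (s + t)"
      by (auto simp: multi_indices_def sum.distrib)
    from poly_deg_le_mfun_I[OF this] show ?case by (simp add: mfun_mult)
  qed (auto simp: poly_deg_le_zero distrib_left mult.left_commute intro: poly_deg_le_add poly_deg_le_cmult)
qed (auto simp: poly_deg_le_zero distrib_right mult.assoc intro: poly_deg_le_add poly_deg_le_cmult)

lemma poly_deg_le_const: "poly_deg_le t (\<lambda>x. c)"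
proof -
  have "(\<lambda>_. 0) \<in> multi_indices t" by (auto simp: multi_indices_def)
  from poly_deg_le_cmult[OF poly_deg_le_mfun_I[OF this], of c] show ?thesis
    by (simp add: mfun_def)
qed

lemma poly_deg_le_coord:
  fixes b :: "'a::euclidean_space" assumes "b \<in> Basis" shows "poly_deg_le 1 (\<lambda>x. x \<bullet> b)"
proof -
  let ?\<alpha> = "\<lambda>i. if i = b then 1 else 0::nat"
  have "?\<alpha> \<in> multi_indices 1" using assms by (auto simp: multi_indices_def)
  moreover have "mfun ?\<alpha> = (\<lambda>x. x \<bullet> b)"
    using assms by (auto simp: mfun_def fun_eq_iff if_distrib[of "\<lambda>n. _ ^ n"] cong: if_cong)
  ultimately show ?thesis using poly_deg_le_mfun_I by metis
qed

lemma poly_deg_le_power: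
  "poly_deg_le s f \<Longrightarrow> poly_deg_le (n * s) (\<lambda>x. f x ^ n)"
  by (induction n) (auto intro: poly_deg_le_const poly_deg_le_mult)

lemma poly_deg_le_prod:
  assumes "finite I" "\<And>i. i \<in> I \<Longrightarrow> poly_deg_le (t i) (f i)"
  shows "poly_deg_le (\<Sum>i\<in>I. t i) (\<lambda>x. \<Prod>i\<in>I. f i x)"
  using assms by (induction I) (auto intro: poly_deg_le_const poly_deg_le_mult)

text \<open>Each coordinate of \<open>R x\<close> is a linear form in \<open>x\<close>, so the
  substitution cannot raise the degree. It is applied to reflections.\<close>

lemma poly_deg_le_linear_compose:
  fixes R :: "'a::euclidean_space \<Rightarrow> 'a"
  assumes "poly_deg_le t f" "linear R"
  shows "poly_deg_le t (\<lambda>x. f (R x))"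
  using assms(1)
proof (induction rule: poly_deg_le_induct)
  case (mono \<alpha>)
  have coord: "poly_deg_le 1 (\<lambda>x. R x \<bullet> i)" for i
  proof -
    have "(\<lambda>x. R x \<bullet> i) = (\<lambda>x. \<Sum>j\<in>Basis. (R j \<bullet> i) * (x \<bullet> j))"
    proof
      fix x
      have "R x = (\<Sum>j\<in>Basis. (x \<bullet> j) *\<^sub>R R j)"
        using linear_sum[OF \<open>linear R\<close>, of "\<lambda>j. (x \<bullet> j) *\<^sub>R j" Basis]
        by (simp add: euclidean_representation linear_cmul[OF \<open>linear R\<close>])
      then show "R x \<bullet> i = (\<Sum>j\<in>Basis. (R j \<bullet> i) * (x \<bullet> j))"
        by (simp add: inner_sum_left mult.commute)
    qed
    then show ?thesis
      by (simp only:) (intro poly_deg_le_sum poly_deg_le_cmult poly_deg_le_coord)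
  qed
  have "poly_deg_le (\<Sum>i\<in>Basis. \<alpha> i * 1) (\<lambda>x. \<Prod>i\<in>Basis. (R x \<bullet> i) ^ \<alpha> i)"
    by (intro poly_deg_le_prod poly_deg_le_power coord) auto
  then show ?case
    unfolding mfun_def using mono by (auto simp: multi_indices_def intro: poly_deg_le_mono)
qed (auto intro: poly_deg_le_zero poly_deg_le_add poly_deg_le_cmult)

text \<open>Below degree 0 only the zero function remains; a bound by the truncated
  \<open>s - 1\<close> would admit the constants when \<open>s = 0\<close>.\<close>

definition poly_deg_less :: "nat \<Rightarrow> ('a::euclidean_space \<Rightarrow> real) \<Rightarrow> bool" where
  "poly_deg_less s f \<longleftrightarrow> (case s of 0 \<Rightarrow> f = (\<lambda>x. 0) | Suc r \<Rightarrow> poly_deg_le r f)"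

lemma poly_deg_less_zero: "poly_deg_less s (\<lambda>x. 0)"
  by (auto simp: poly_deg_less_def poly_deg_le_zero split: nat.split)

lemma poly_deg_less_add:
  "poly_deg_less s f \<Longrightarrow> poly_deg_less s g \<Longrightarrow> poly_deg_less s (\<lambda>x. f x + g x)"
  by (auto simp: poly_deg_less_def poly_deg_le_add split: nat.splits)

lemma poly_deg_less_cmult: "poly_deg_less s f \<Longrightarrow> poly_deg_less s (\<lambda>x. c * f x)"
  by (auto simp: poly_deg_less_def poly_deg_le_cmult split: nat.splits)

lemma poly_deg_less_sum:
  assumes "\<And>i. i \<in> I \<Longrightarrow> poly_deg_less t (f i)" shows "poly_deg_less t (\<lambda>x. \<Sum>i\<in>I. f i x)"
  using assms
  by (induction I rule: infinite_finite_induct) (auto intro: poly_deg_less_zero poly_deg_less_add)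

lemma poly_deg_less_imp_le: "poly_deg_less s f \<Longrightarrow> poly_deg_le s f"
  by (auto simp: poly_deg_less_def poly_deg_le_zero intro: poly_deg_le_mono split: nat.splits)

lemma poly_deg_less_coord_mult:
  "b \<in> Basis \<Longrightarrow> poly_deg_less s f \<Longrightarrow> poly_deg_le s (\<lambda>x. (x \<bullet> b) * f x)"
  using poly_deg_le_mult[OF poly_deg_le_coord]
  by (auto simp: poly_deg_less_def poly_deg_le_zero split: nat.splits)

subsection \<open>Partial derivatives\<close>

definition pd :: "'a::euclidean_space \<Rightarrow> ('a \<Rightarrow> real) \<Rightarrow> 'a \<Rightarrow> real" where
  "pd i f x = frechet_derivative f (at x) i"

lemma pd_eq: "(f has_derivative f') (at x) \<Longrightarrow> pd i f x = f' i"
  unfolding pd_def by (metis frechet_derivative_at)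

text \<open>For \<open>\<alpha> i = 0\<close> the truncated exponent \<open>\<alpha> i - 1\<close>
  is harmless, as the factor \<open>of_nat (\<alpha> i)\<close> is 0.\<close>

lemma mfun_has_derivative:
  fixes \<alpha> :: "'a::euclidean_space \<Rightarrow> nat"
  shows "(mfun \<alpha> has_derivative
     (\<lambda>v. \<Sum>i\<in>Basis. (v \<bullet> i) * (of_nat (\<alpha> i) * mfun (\<alpha>(i := \<alpha> i - 1)) x))) (at x)"
proof -
  have "((\<lambda>x. \<Prod>i\<in>Basis. (x \<bullet> i) ^ \<alpha> i) has_derivative
      (\<lambda>v. \<Sum>i\<in>Basis. (of_nat (\<alpha> i) * (v \<bullet> i) * (x \<bullet> i) ^ (\<alpha> i - 1)) * (\<Prod>j\<in>Basis - {i}. (x \<bullet> j) ^ \<alpha> j))) (at x)"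
    by (rule has_derivative_prod) (auto intro!: derivative_eq_intros simp: fun_eq_iff)
  also have "(\<lambda>v. \<Sum>i\<in>Basis. (of_nat (\<alpha> i) * (v \<bullet> i) * (x \<bullet> i) ^ (\<alpha> i - 1)) * (\<Prod>j\<in>Basis - {i}. (x \<bullet> j) ^ \<alpha> j))
     = (\<lambda>v. \<Sum>i\<in>Basis. (v \<bullet> i) * (of_nat (\<alpha> i) * mfun (\<alpha>(i := \<alpha> i - 1)) x))"
  proof (intro ext sum.cong refl)
    fix v i :: 'a assume "i \<in> Basis"
    then have "mfun (\<alpha>(i := \<alpha> i - 1)) x = (x \<bullet> i) ^ (\<alpha> i - 1) * (\<Prod>j\<in>Basis - {i}. (x \<bullet> j) ^ \<alpha> j)"
      unfolding mfun_def by (subst prod.remove[of _ i]) (auto intro!: prod.cong)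
    then show "of_nat (\<alpha> i) * (v \<bullet> i) * (x \<bullet> i) ^ (\<alpha> i - 1) * (\<Prod>j\<in>Basis - {i}. (x \<bullet> j) ^ \<alpha> j) =
         (v \<bullet> i) * (of_nat (\<alpha> i) * mfun (\<alpha>(i := \<alpha> i - 1)) x)"
      by simp
  qed
  finally show ?thesis by (simp add: mfun_def [abs_def])
qed

lemma inner_Basis_sum:
  fixes i :: "'a::euclidean_space"
  assumes "i \<in> Basis" shows "(\<Sum>j\<in>Basis. (i \<bullet> j) * c j) = (c i :: real)"
  using assms by (auto simp: inner_Basis if_distrib[of "\<lambda>c. c * _"] cong: if_cong)

lemma pd_mfun:
  "i \<in> Basis \<Longrightarrow> pd i (mfun \<alpha>) = (\<lambda>x. of_nat (\<alpha> i) * mfun (\<alpha>(i := \<alpha> i - 1)) x)"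
  by (simp add: pd_eq[OF mfun_has_derivative] fun_eq_iff inner_Basis_sum)

section \<open>Differentiation of polynomials of unspecified degree\<close>

definition is_poly :: "('a::euclidean_space \<Rightarrow> real) \<Rightarrow> bool" where
  "is_poly f \<longleftrightarrow> (\<exists>t. poly_deg_le t f)"

lemma is_polyI: "poly_deg_le t f \<Longrightarrow> is_poly f" by (auto simp: is_poly_def)

lemma is_poly_zero: "is_poly (\<lambda>x. 0)" by (rule is_polyI[OF poly_deg_le_zero])

lemma is_poly_const: "is_poly (\<lambda>x. c)" by (rule is_polyI[OF poly_deg_le_const])

lemma is_poly_coord: "b \<in> Basis \<Longrightarrow> is_poly (\<lambda>x. x \<bullet> b)" by (rule is_polyI[OF poly_deg_le_coord])

lemma is_poly_add: assumes "is_poly f" "is_poly g" shows "is_poly (\<lambda>x. f x + g x)"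
proof -
  obtain s t where "poly_deg_le s f" "poly_deg_le t g" using assms by (auto simp: is_poly_def)
  then have "poly_deg_le (max s t) f" "poly_deg_le (max s t) g" by (auto intro: poly_deg_le_mono)
  then show ?thesis by (auto intro: is_polyI poly_deg_le_add)
qed

lemma is_poly_mult: "is_poly f \<Longrightarrow> is_poly g \<Longrightarrow> is_poly (\<lambda>x. f x * g x)"
  unfolding is_poly_def using poly_deg_le_mult by blast

lemma is_poly_diff: "is_poly f \<Longrightarrow> is_poly g \<Longrightarrow> is_poly (\<lambda>x. f x - g x)"
  using is_poly_add[of f "\<lambda>x. -1 * g x"] is_poly_mult[OF is_poly_const, of g "-1"] by simp

lemma is_poly_sum: "(\<And>i. i \<in> I \<Longrightarrow> is_poly (f i)) \<Longrightarrow> is_poly (\<lambda>x. \<Sum>i\<in>I. f i x)"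
  by (induction I rule: infinite_finite_induct) (auto intro: is_poly_zero is_poly_add)

lemma is_poly_power: "is_poly f \<Longrightarrow> is_poly (\<lambda>x. f x ^ n)"
  by (induction n) (auto intro: is_poly_const is_poly_mult)

lemmas is_poly_intros =
  is_poly_zero is_poly_const is_poly_coord is_poly_add is_poly_mult is_poly_diff is_poly_sum is_poly_power

lemma is_poly_has_derivative:
  fixes f :: "'a::euclidean_space \<Rightarrow> real"
  assumes "is_poly f"
  shows "(f has_derivative (\<lambda>v. \<Sum>i\<in>Basis. (v \<bullet> i) * pd i f x)) (at x)"
proof -
  obtain t where "poly_deg_le t f" using assms by (auto simp: is_poly_def)
  then have "\<exists>f'. (f has_derivative f') (at x)"
    by (induction rule: poly_deg_le_induct)
       (use mfun_has_derivative has_derivative_add has_derivative_mult_right has_derivative_const in blast)+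
  then obtain f' where f': "(f has_derivative f') (at x)" by blast
  then have "linear f'" by (rule has_derivative_linear)
  have "f' v = (\<Sum>i\<in>Basis. (v \<bullet> i) * pd i f x)" for v
    using linear_sum[OF \<open>linear f'\<close>, of "\<lambda>i. (v \<bullet> i) *\<^sub>R i" Basis]
    by (simp add: euclidean_representation linear_cmul[OF \<open>linear f'\<close>] pd_eq[OF f'])
  then have "f' = (\<lambda>v. \<Sum>i\<in>Basis. (v \<bullet> i) * pd i f x)" by blast
  with f' show ?thesis by simp
qed

lemma is_poly_continuous_on: "is_poly f \<Longrightarrow> continuous_on S f"
  by (meson continuous_at_imp_continuous_on has_derivative_continuous is_poly_has_derivative)

lemma pd_add: "is_poly f \<Longrightarrow> is_poly g \<Longrightarrow> pd i (\<lambda>x. f x + g x) = (\<lambda>x. pd i f x + pd i g x)"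
  by (intro ext)
     (simp add: pd_eq[OF is_poly_has_derivative] pd_eq[OF has_derivative_add[OF is_poly_has_derivative is_poly_has_derivative]])

lemma pd_diff: "is_poly f \<Longrightarrow> is_poly g \<Longrightarrow> pd i (\<lambda>x. f x - g x) = (\<lambda>x. pd i f x - pd i g x)"
  by (intro ext)
     (simp add: pd_eq[OF is_poly_has_derivative] pd_eq[OF has_derivative_diff[OF is_poly_has_derivative is_poly_has_derivative]])

lemma pd_mult: "is_poly f \<Longrightarrow> is_poly g \<Longrightarrow>
    pd i (\<lambda>x. f x * g x) = (\<lambda>x. f x * pd i g x + pd i f x * g x)"
  by (intro ext)
     (simp add: pd_eq[OF is_poly_has_derivative] pd_eq[OF has_derivative_mult[OF is_poly_has_derivative is_poly_has_derivative]])

lemma pd_const: "pd i (\<lambda>x. c) = (\<lambda>x. 0)"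
  by (intro ext) (simp add: pd_eq[OF has_derivative_const])

lemma pd_cmult: "is_poly f \<Longrightarrow> pd i (\<lambda>x. c * f x) = (\<lambda>x. c * pd i f x)"
  by (simp add: pd_mult is_poly_const pd_const)

lemma pd_sum: "(\<And>k. k \<in> I \<Longrightarrow> is_poly (f k)) \<Longrightarrow> pd i (\<lambda>x. \<Sum>k\<in>I. f k x) = (\<lambda>x. \<Sum>k\<in>I. pd i (f k) x)"
  by (induction I rule: infinite_finite_induct) (auto simp: pd_const pd_add is_poly_sum)

lemma pd_coord: "pd i (\<lambda>x. x \<bullet> j) = (\<lambda>x. i \<bullet> j)"
  by (intro ext) (rule pd_eq, auto intro!: derivative_eq_intros)

lemma poly_deg_less_pd:
  assumes "poly_deg_le t f" "i \<in> Basis" shows "poly_deg_less t (pd i f)"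
  using assms(1)
proof (induction rule: poly_deg_le_induct)
  case (mono \<alpha>)
  show ?case
  proof (cases "\<alpha> i = 0")
    case False
    have "sum \<alpha> Basis = \<alpha> i + sum \<alpha> (Basis - {i})"
      using assms(2) by (simp add: sum.remove)
    moreover have "sum (\<alpha>(i := \<alpha> i - 1)) Basis = (\<alpha> i - 1) + sum \<alpha> (Basis - {i})"
      using assms(2) by (simp add: sum.remove)
    ultimately have "t \<noteq> 0" "\<alpha>(i := \<alpha> i - 1) \<in> multi_indices (t - 1)"
      using mono False assms(2) by (auto simp: multi_indices_def)
    then show ?thesis
      using assms(2) by (cases t) (auto simp: pd_mfun poly_deg_less_def intro!: poly_deg_le_cmult poly_deg_le_mfun_I)
  qed (simp add: pd_mfun assms poly_deg_less_zero)
next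
  case zero show ?case by (simp add: pd_const poly_deg_less_zero)
qed (auto simp: pd_add pd_cmult is_polyI intro: poly_deg_less_add poly_deg_less_cmult)

lemma is_poly_pd: "is_poly f \<Longrightarrow> i \<in> Basis \<Longrightarrow> is_poly (pd i f)"
  using poly_deg_less_pd poly_deg_less_imp_le is_poly_def by metis

section \<open>Radial derivative, Laplacian and infinitesimal rotations\<close>

definition euler :: "('a::euclidean_space \<Rightarrow> real) \<Rightarrow> 'a \<Rightarrow> real" where
  "euler f x = (\<Sum>i\<in>Basis. (x \<bullet> i) * pd i f x)"

definition laplacian :: "('a::euclidean_space \<Rightarrow> real) \<Rightarrow> 'a \<Rightarrow> real" where
  "laplacian f x = (\<Sum>i\<in>Basis. pd i (pd i f) x)"

text \<open>Derivative along the vector field \<open>x_i e_j - x_j e_i\<close>, which generates the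
  rotations in the plane of \<open>i\<close> and \<open>j\<close> and is tangent to every sphere
  around 0.\<close>

definition rot :: "'a::euclidean_space \<Rightarrow> 'a \<Rightarrow> ('a \<Rightarrow> real) \<Rightarrow> 'a \<Rightarrow> real" where
  "rot i j f x = (x \<bullet> i) * pd j f x - (x \<bullet> j) * pd i f x"

lemma is_poly_euler: "is_poly f \<Longrightarrow> is_poly (euler f)"
  unfolding euler_def [abs_def] by (intro is_poly_intros is_poly_pd)

lemma is_poly_rot: "is_poly f \<Longrightarrow> i \<in> Basis \<Longrightarrow> j \<in> Basis \<Longrightarrow> is_poly (rot i j f)"
  unfolding rot_def [abs_def] by (intro is_poly_intros is_poly_pd)

lemma euler_add: "is_poly f \<Longrightarrow> is_poly g \<Longrightarrow> euler (\<lambda>x. f x + g x) = (\<lambda>x. euler f x + euler g x)"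
  by (auto simp: euler_def fun_eq_iff pd_add sum.distrib algebra_simps)

lemma euler_cmult: "is_poly f \<Longrightarrow> euler (\<lambda>x. c * f x) = (\<lambda>x. c * euler f x)"
  by (auto simp: euler_def fun_eq_iff pd_cmult sum_distrib_left algebra_simps)

lemma euler_mfun: "euler (mfun \<alpha>) x = real (sum \<alpha> Basis) * mfun \<alpha> x"
proof -
  have "(x \<bullet> i) * pd i (mfun \<alpha>) x = real (\<alpha> i) * mfun \<alpha> x" if "i \<in> Basis" for i
  proof (cases "\<alpha> i = 0")
    case False
    have "(x \<bullet> i) * mfun (\<alpha>(i := \<alpha> i - 1)) x = mfun \<alpha> x"
      unfolding mfun_def using that False
      by (subst (1 2) prod.remove[of _ i]) (auto simp: power_Suc[symmetric] mult.assoc[symmetric] simp del: power_Suc intro!: prod.cong)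
    then show ?thesis using that by (simp add: pd_mfun mult.left_commute)
  qed (simp add: pd_mfun that)
  then show ?thesis by (simp add: euler_def sum_distrib_right)
qed

text \<open>Euler's identity: a monomial is an eigenfunction of \<open>euler\<close> whose
  eigenvalue is its degree, so subtracting \<open>t\<close> times the function removes the part of
  degree \<open>t\<close>.\<close>

lemma poly_deg_less_euler:
  fixes f :: "'a::euclidean_space \<Rightarrow> real"
  assumes "poly_deg_le t f" shows "poly_deg_less t (\<lambda>x. euler f x - real t * f x)"
  using assms
proof (induction rule: poly_deg_le_induct)
  case (mono \<alpha>)
  show ?case
  proof (cases "sum \<alpha> Basis = t")
    case True then show ?thesis by (simp add: euler_mfun poly_deg_less_zero)
  next
    case False
    with mono have "t \<noteq> 0" "\<alpha> \<in> multi_indices (t - 1)" by (auto simp: multi_indices_def)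
    then have "poly_deg_less t (mfun \<alpha>)" by (cases t) (auto simp: poly_deg_less_def intro: poly_deg_le_mfun_I)
    then have "poly_deg_less t (\<lambda>x. (real (sum \<alpha> Basis) - real t) * mfun \<alpha> x)" by (rule poly_deg_less_cmult)
    then show ?thesis by (simp add: euler_mfun algebra_simps)
  qed
next
  case zero then show ?case by (simp add: euler_def pd_const poly_deg_less_zero)
next
  case (add f g)
  then show ?case using poly_deg_less_add[OF add(3,4)]
    by (simp add: euler_add is_polyI algebra_simps)
next
  case (scale c f)
  then show ?case using poly_deg_less_cmult[OF scale(2), of c]
    by (simp add: euler_cmult is_polyI algebra_simps)
qed

lemma euler_euler:
  fixes f :: "'a::euclidean_space \<Rightarrow> real"
  assumes "is_poly f"
  shows "euler (euler f) x = euler f x + (\<Sum>i\<in>Basis. \<Sum>j\<in>Basis. (x \<bullet> i) * (x \<bullet> j) * pd i (pd j f) x)"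
proof -
  have "pd i (euler f) x = (\<Sum>j\<in>Basis. (x \<bullet> j) * pd i (pd j f) x) + pd i f x" if "i \<in> Basis" for i
    unfolding euler_def [abs_def] using assms that
    by (simp add: pd_sum pd_mult pd_coord is_poly_coord is_poly_mult is_poly_pd sum.distrib inner_Basis_sum)
  then show ?thesis
    unfolding euler_def[of "euler f"]
    by (simp add: distrib_left sum.distrib sum_distrib_left mult.assoc) (simp add: euler_def)
qed

text \<open>Polar coordinates: \<open>|x|^2\<close> times the Laplacian is
  \<open>E^2 + (D - 2) E\<close> plus the spherical Laplacian, with \<open>E\<close> the Euler
  operator and \<open>D\<close> the dimension, and the squared rotation fields sum to the spherical
  part. Ordered pairs count every plane twice, hence the factor 2.\<close>

lemma sum_rot_rot:
  fixes f :: "'a::euclidean_space \<Rightarrow> real"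
  assumes f: "is_poly f"
  shows "(\<Sum>i\<in>Basis. \<Sum>j\<in>Basis. rot i j (rot i j f) x) =
    2 * ((x \<bullet> x) * laplacian f x - euler (euler f) x - (real DIM('a) - 2) * euler f x)"
proof -
  \<comment> \<open>The last summand can be nonzero only for \<open>i = j\<close>; there it makes
    the right side vanish, as \<open>rot i i\<close> does.\<close>
  have rr: "rot i j (rot i j f) x =
      (x \<bullet> i) * (x \<bullet> i) * pd j (pd j f) x + (x \<bullet> j) * (x \<bullet> j) * pd i (pd i f) x
      - (x \<bullet> i) * pd i f x - (x \<bullet> j) * pd j f x
      - (x \<bullet> i) * (x \<bullet> j) * pd i (pd j f) x - (x \<bullet> j) * (x \<bullet> i) * pd j (pd i f) x
      + 2 * ((i \<bullet> j) * ((x \<bullet> i) * pd j f x))"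
    if "i \<in> Basis" "j \<in> Basis" for i j
  proof -
    have 1: "pd k (rot i j f) x = (x \<bullet> i) * pd k (pd j f) x + (k \<bullet> i) * pd j f x
       - ((x \<bullet> j) * pd k (pd i f) x + (k \<bullet> j) * pd i f x)" for k
      unfolding rot_def [abs_def] using that f
      by (simp add: pd_diff pd_mult pd_coord is_poly_coord is_poly_mult is_poly_pd)
    show ?thesis
      unfolding rot_def[of i j "rot i j f"] 1
      using that by (cases "i = j") (auto simp: inner_Basis algebra_simps)
  qed
  have sw: "(\<Sum>i\<in>Basis. \<Sum>j\<in>Basis. (x \<bullet> j) * (x \<bullet> i) * pd j (pd i f) x) =
        (\<Sum>i\<in>Basis. \<Sum>j\<in>Basis. (x \<bullet> i) * (x \<bullet> j) * pd i (pd j f) x)"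
    by (rule sum.swap)
  have xx: "x \<bullet> x = (\<Sum>i\<in>Basis. (x \<bullet> i) * (x \<bullet> i))"
    by (rule euclidean_inner)
  have l1: "(\<Sum>i\<in>Basis. \<Sum>j\<in>Basis. (x \<bullet> i) * (x \<bullet> i) * pd j (pd j f) x) = (x \<bullet> x) * laplacian f x"
    by (simp add: xx laplacian_def sum_product)
  have l2: "(\<Sum>i\<in>Basis. \<Sum>j\<in>Basis. (x \<bullet> j) * (x \<bullet> j) * pd i (pd i f) x) = (x \<bullet> x) * laplacian f x"
    by (subst sum.swap) (rule l1)
  have e1: "(\<Sum>i\<in>(Basis::'a set). \<Sum>j\<in>(Basis::'a set). (x \<bullet> i) * pd i f x) = real DIM('a) * euler f x"
    by (simp add: euler_def sum_distrib_left)
  have e2: "(\<Sum>i\<in>(Basis::'a set). \<Sum>j\<in>(Basis::'a set). (x \<bullet> j) * pd j f x) = real DIM('a) * euler f x"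
    by (simp add: euler_def)
  have e3: "(\<Sum>i\<in>(Basis::'a set). \<Sum>j\<in>(Basis::'a set). 2 * ((i \<bullet> j) * ((x \<bullet> i) * pd j f x))) = 2 * euler f x"
    unfolding sum_distrib_left[symmetric] by (simp add: inner_Basis_sum euler_def)
  have "(\<Sum>i\<in>Basis. \<Sum>j\<in>Basis. rot i j (rot i j f) x) = 2 * ((x \<bullet> x) * laplacian f x)
      - 2 * (real DIM('a) * euler f x) - 2 * (euler (euler f) x - euler f x) + 2 * euler f x"
    by (simp only: rr sum.distrib sum_subtractf l1 l2 e1 e2 e3 sw euler_euler[OF f] cong: sum.cong) (simp add: algebra_simps)
  then show ?thesis by (simp add: algebra_simps)
qed

lemma poly_deg_less_laplacian:
  "poly_deg_le t f \<Longrightarrow> poly_deg_less t (laplacian f)"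
  unfolding laplacian_def [abs_def]
  by (intro poly_deg_less_sum) (meson poly_deg_less_imp_le poly_deg_less_pd)

lemma poly_deg_less_euler_le:
  "poly_deg_less t f \<Longrightarrow> poly_deg_less t (euler f)"
proof -
  assume a: "poly_deg_less t f"
  show ?thesis
  proof (cases t)
    case 0 then show ?thesis using a by (simp add: poly_deg_less_def euler_def [abs_def] pd_const)
  next
    case (Suc r)
    then have "poly_deg_le r (euler f)"
      unfolding euler_def [abs_def] using a
      by (auto intro!: poly_deg_le_sum poly_deg_less_coord_mult poly_deg_less_pd simp: poly_deg_less_def)
    then show ?thesis by (simp add: Suc poly_deg_less_def)
  qed
qed

text \<open>On the unit sphere the sum of the squared rotation fields is twice the Laplace--Beltrami
  operator, which acts on degree \<open>s\<close> as the scalar \<open>- s (s + d - 1)\<close> up to lower degree.\<close>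

lemma sum_rot_rot_sphere:
  fixes f :: "'a::euclidean_space \<Rightarrow> real"
  assumes "poly_deg_le s f"
  shows "\<exists>g. poly_deg_less s g \<and> (\<forall>x\<in>sphere 0 1. (\<Sum>i\<in>Basis. \<Sum>j\<in>Basis. rot i j (rot i j f) x) =
     - (2 * real s * (real s + real DIM('a) - 2)) * f x + g x)"
proof -
  let ?h = "\<lambda>x. euler f x - real s * f x"
  have f: "is_poly f" using assms by (rule is_polyI)
  have h: "poly_deg_less s ?h" by (rule poly_deg_less_euler[OF assms])
  have "euler (\<lambda>x. ?h x + real s * f x) = (\<lambda>x. euler ?h x + euler (\<lambda>x. real s * f x) x)"
    by (intro euler_add is_poly_intros is_poly_euler f)
  then have ee: "euler (euler f) x = euler ?h x + real s * euler f x" for x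
    using f by (simp add: euler_cmult)
  \<comment> \<open>With \<open>h = E f - s f\<close> one has \<open>E^2 f = E h + s E f\<close>;
    replacing the remaining \<open>E f\<close> by \<open>s f + h\<close> leaves the multiple of
    \<open>f\<close> and this remainder.\<close>
  define g where "g = (\<lambda>x. 2 * laplacian f x + ((-2) * euler ?h x + (-2 * (real s + real DIM('a) - 2)) * ?h x))"
  have "poly_deg_less s g"
    unfolding g_def
    by (intro poly_deg_less_add poly_deg_less_cmult poly_deg_less_laplacian assms h poly_deg_less_euler_le)
  moreover have "(\<Sum>i\<in>Basis. \<Sum>j\<in>Basis. rot i j (rot i j f) x) =
     - (2 * real s * (real s + real DIM('a) - 2)) * f x + g x" if "x \<in> sphere 0 1" for x
  proof -
    have "x \<bullet> x = 1" using that by (simp add: dot_square_norm)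
    then show ?thesis unfolding sum_rot_rot[OF f] g_def ee by (simp add: algebra_simps)
  qed
  ultimately show ?thesis by blast
qed

section \<open>The surface measure\<close>

text \<open>The reflection in the hyperplane orthogonal to \<open>w\<close>. For
  \<open>w = 0\<close> it is the identity, so that \<open>householder_maps\<close> also covers
  \<open>x = y\<close>.\<close>

definition householder :: "'a::euclidean_space \<Rightarrow> 'a \<Rightarrow> 'a" where
  "householder w z = z - (2 * (z \<bullet> w) / (w \<bullet> w)) *\<^sub>R w"

lemma linear_householder: "linear (householder w)"
  by (rule linearI) (auto simp: householder_def inner_add_left algebra_simps add_divide_distrib)

lemma householder_inner: "householder w x \<bullet> householder w y = x \<bullet> y"
  by (cases "w = 0") (auto simp: householder_def inner_diff_left inner_diff_right inner_commute field_simps)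

lemma householder_involution: "householder w (householder w x) = x"
  by (cases "w = 0") (auto simp: householder_def inner_diff_left inner_diff_right algebra_simps)

lemma norm_householder: "norm (householder w x) = norm x"
  by (simp add: norm_eq_sqrt_inner householder_inner)

text \<open>Equal norms put the origin on the perpendicular bisector of \<open>x\<close> and
  \<open>y\<close>, which is the mirror of this reflection.\<close>

lemma householder_maps:
  assumes "norm x = norm y" shows "householder (x - y) x = y"
proof (cases "x = y")
  case False
  have "2 * (x \<bullet> (x - y)) = (x - y) \<bullet> (x - y)"
    using assms by (simp add: inner_diff_left inner_diff_right inner_commute norm_eq)
  then show ?thesis using False by (simp add: householder_def)
qed (simp add: householder_def)

lemma householder_fixes: "x \<bullet> w = 0 \<Longrightarrow> householder w x = x"
  by (simp add: householder_def)

lemma measurable_householder [measurable]: "householder w \<in> borel_measurable borel"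
  by (intro borel_measurable_continuous_onI linear_continuous_on linear_householder[unfolded linear_conv_bounded_linear])

lemma nn_integral_lborel_isometric_affine:
  fixes g :: "'a::euclidean_space \<Rightarrow> ennreal"
  assumes [measurable]: "g \<in> borel_measurable borel" and "\<bar>c\<bar> = 1"
  shows "(\<integral>\<^sup>+x. g (a + c *\<^sub>R x) \<partial>lborel) = (\<integral>\<^sup>+x. g x \<partial>lborel)"
proof -
  have "c \<noteq> 0" using assms(2) by auto
  show ?thesis
    by (subst (2) lborel_affine[OF \<open>c \<noteq> 0\<close>, of a])
       (simp add: assms(2) nn_integral_density nn_integral_distr)
qed

lemma emeasure_unit_ball_pos: "emeasure lborel (ball (0::'a::euclidean_space) 1) > 0"
  using content_ball_pos[of 1 "0::'a"] emeasure_lborel_ball_finite[of "0::'a" 1]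
  by (simp add: Sigma_Algebra.measure_def enn2real_positive_iff)

text \<open>Uniqueness of Haar measure by Fubini: both sides of the identity
  \<open>\<lambda>(R\<^sup>-\<^sup>1 A) \<lambda>(B) = \<lambda>(A) \<lambda>(R\<^sup>-\<^sup>1 B)\<close> evaluate the same double integral, and the unit ball \<open>B\<close> is
  invariant under the reflection \<open>R\<close>.\<close>

lemma emeasure_lborel_householder:
  fixes w :: "'a::euclidean_space"
  assumes [measurable]: "A \<in> sets borel"
  shows "emeasure lborel (householder w -` A) = emeasure lborel A"
proof -
  let ?f = "householder w" and ?B = "ball (0::'a) 1"
  have fA [measurable]: "?f -` A \<in> sets borel"
    using measurable_sets_borel[OF measurable_householder assms] by simp
  have [measurable]: "(indicator ?B :: 'a \<Rightarrow> ennreal) \<in> borel_measurable borel"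
    by (intro borel_measurable_indicator) auto
  have fB: "?f -` ?B = ?B" by (auto simp: norm_householder)
  have indicator_ball: "indicator ?B (?f x) = (indicator ?B x :: ennreal)" for x
    by (simp add: indicator_def norm_householder)
  have nn_integral_ball: "(\<integral>\<^sup>+x. indicator ?B x \<partial>lborel) = emeasure lborel ?B"
    by (rule nn_integral_indicator) simp
  have f_diff: "?f (x - ?f y) = ?f x - y" for x y
    by (simp add: linear_diff[OF linear_householder] householder_involution)
  have "emeasure lborel (?f -` A) * emeasure lborel ?B
      = (\<integral>\<^sup>+x. indicator A (?f x) * emeasure lborel ?B \<partial>lborel)"
    by (subst nn_integral_multc) (auto simp: nn_integral_indicator[symmetric] indicator_vimage[symmetric] simp del: nn_integral_indicator intro!: nn_integral_cong)
  also have "\<dots> = (\<integral>\<^sup>+x. indicator A (?f x) * (\<integral>\<^sup>+y. indicator ?B (?f x + 1 *\<^sub>R y) \<partial>lborel) \<partial>lborel)"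
    by (subst nn_integral_lborel_isometric_affine) auto
  also have "\<dots> = (\<integral>\<^sup>+x. (\<integral>\<^sup>+y. indicator A (?f x) * indicator ?B (?f x + y) \<partial>lborel) \<partial>lborel)"
    by (subst nn_integral_cmult[symmetric]) auto
  also have "\<dots> = (\<integral>\<^sup>+y. (\<integral>\<^sup>+x. indicator A (?f x) * indicator ?B (?f x + y) \<partial>lborel) \<partial>lborel)"
    by (rule lborel_pair.Fubini'[symmetric]) measurable
  \<comment> \<open>For fixed \<open>y\<close>, translate \<open>x\<close> by \<open>- ?f y\<close>.
    By \<open>f_diff\<close> this moves \<open>y\<close> from the factor of the ball to the factor
    of \<open>A\<close>, so that after the second exchange of integrals \<open>A\<close> can be
    integrated out.\<close>
  also have "\<dots> = (\<integral>\<^sup>+y. (\<integral>\<^sup>+x. indicator A (?f (- ?f y + 1 *\<^sub>R x)) * indicator ?B (?f (- ?f y + 1 *\<^sub>R x) + y) \<partial>lborel) \<partial>lborel)"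
    by (intro nn_integral_cong nn_integral_lborel_isometric_affine[symmetric]) auto
  also have "\<dots> = (\<integral>\<^sup>+y. (\<integral>\<^sup>+x. indicator A (?f x - y) * indicator ?B (?f x) \<partial>lborel) \<partial>lborel)"
    by (simp add: f_diff)
  also have "\<dots> = (\<integral>\<^sup>+x. (\<integral>\<^sup>+y. indicator A (?f x - y) * indicator ?B (?f x) \<partial>lborel) \<partial>lborel)"
    by (rule lborel_pair.Fubini') measurable
  also have "\<dots> = (\<integral>\<^sup>+x. (\<integral>\<^sup>+y. indicator A (?f x + (-1) *\<^sub>R y) \<partial>lborel) * indicator ?B (?f x) \<partial>lborel)"
    by (subst nn_integral_multc) auto
  also have "\<dots> = (\<integral>\<^sup>+x. emeasure lborel A * indicator ?B (?f x) \<partial>lborel)"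
    by (subst nn_integral_lborel_isometric_affine) auto
  also have "\<dots> = emeasure lborel A * emeasure lborel (?f -` ?B)"
    by (subst nn_integral_cmult) (auto simp: indicator_ball nn_integral_ball fB)
  finally have "emeasure lborel (?f -` A) * emeasure lborel ?B = emeasure lborel A * emeasure lborel ?B"
    unfolding fB .
  then show ?thesis
    using emeasure_unit_ball_pos[where 'a='a] emeasure_lborel_ball_finite[of "0::'a" 1]
    by (metis ennreal_mult_cancel_left infinity_ennreal_def less_irrefl mult.commute)
qed

section \<open>Reflection invariance and support of the surface measure\<close>

lemma sets_sphere_measure [simp, measurable_cong]: "sets sphere_measure = sets borel"
  and space_sphere_measure [simp]: "space sphere_measure = UNIV"
  by (simp_all add: sphere_measure_def)

lemma emeasure_sphere_measure_UNIV: "emeasure (sphere_measure :: 'a::euclidean_space measure) UNIV = 1"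
  unfolding sphere_measure_def
  using emeasure_unit_ball_pos[where 'a='a] emeasure_lborel_ball_finite[of "0::'a" 1]
  by (subst emeasure_distr) (auto intro!: ennreal_divide_self)

lemma finite_measure_sphere: "finite_measure sphere_measure"
  by (rule finite_measureI) (simp add: emeasure_sphere_measure_UNIV)

lemma measure_sphere_measure_UNIV: "measure sphere_measure UNIV = 1"
  by (simp add: Sigma_Algebra.measure_def emeasure_sphere_measure_UNIV)

text \<open>The uniform measure on the ball is invariant, and radial projection commutes with
  norm-preserving linear maps.\<close>

lemma distr_sphere_measure_householder:
  "distr sphere_measure borel (householder w) = (sphere_measure :: 'a::euclidean_space measure)"
proof -
  let ?U = "uniform_measure lborel (ball (0::'a) 1)" and ?p = "\<lambda>x::'a. x /\<^sub>R norm x"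
  have U: "distr ?U borel (householder w) = ?U"
  proof (rule measure_eqI)
    fix A assume "A \<in> sets (distr ?U borel (householder w))"
    then have [measurable]: "A \<in> sets borel" by simp
    have [measurable]: "householder w -` A \<in> sets borel"
      using measurable_sets_borel[OF measurable_householder \<open>A \<in> sets borel\<close>] by simp
    have "ball 0 1 \<inter> householder w -` A = householder w -` (ball 0 1 \<inter> A)"
      by (auto simp: norm_householder)
    then have "emeasure lborel (ball 0 1 \<inter> householder w -` A) = emeasure lborel (ball 0 1 \<inter> A)"
      by (simp only:) (rule emeasure_lborel_householder, measurable)
    then show "emeasure (distr ?U borel (householder w)) A = emeasure ?U A"
      by (simp add: emeasure_distr)
  qed simp
  have "distr sphere_measure borel (householder w) = distr ?U borel (householder w \<circ> ?p)"
    unfolding sphere_measure_def by (rule distr_distr) auto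
  also have "householder w \<circ> ?p = ?p \<circ> householder w"
    by (auto simp: fun_eq_iff norm_householder linear_cmul[OF linear_householder])
  also have "distr ?U borel (?p \<circ> householder w) = distr (distr ?U borel (householder w)) borel ?p"
    by (rule distr_distr[symmetric]) auto
  finally show ?thesis unfolding U by (simp add: sphere_measure_def)
qed

lemma integral_sphere_householder:
  fixes f :: "'a::euclidean_space \<Rightarrow> real"
  assumes [measurable]: "f \<in> borel_measurable borel"
  shows "(\<integral>x. f (householder w x) \<partial>sphere_measure) = (\<integral>x. f x \<partial>sphere_measure)"
  by (subst (2) distr_sphere_measure_householder[of w, symmetric])
     (rule integral_distr[symmetric], auto)

text \<open>The origin is the only point that the radial projection does not send to the sphere (it
  stays at 0), and it is a null set.\<close>

lemma AE_sphere_measure: "AE x in sphere_measure. x \<in> sphere (0::'a::euclidean_space) 1"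
  unfolding sphere_measure_def
proof (subst AE_distr_iff)
  show "AE x in uniform_measure lborel (ball (0::'a) 1). x /\<^sub>R norm x \<in> sphere 0 1"
    by (rule AE_uniform_measureI) (auto intro: eventually_mono[OF AE_lborel_singleton[of 0]])
qed auto

lemma is_poly_measurable [measurable_dest]: "is_poly f \<Longrightarrow> f \<in> borel_measurable borel"
  by (rule borel_measurable_continuous_onI[OF is_poly_continuous_on])

lemma integrable_is_poly:
  fixes f :: "'a::euclidean_space \<Rightarrow> real"
  assumes "is_poly f" shows "integrable sphere_measure f"
proof -
  have "compact (f ` sphere 0 1)"
    by (intro compact_continuous_image is_poly_continuous_on assms compact_sphere)
  then obtain B where B: "\<And>x. x \<in> sphere 0 1 \<Longrightarrow> norm (f x) \<le> B"
    using compact_imp_bounded bounded_iff by (metis imageI)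
  have "AE x in sphere_measure. norm (f x) \<le> B"
    using AE_sphere_measure by eventually_elim (rule B)
  moreover have "f \<in> borel_measurable sphere_measure"
    using is_poly_measurable[OF assms] by (simp cong: measurable_cong_sets)
  ultimately show ?thesis
    by (intro finite_measure.integrable_const_bound[OF finite_measure_sphere])
qed

text \<open>On polynomials of the ambient space this form is only semidefinite; by
  \<open>ip_eq_0_imp\<close> the polynomials of norm 0 vanish on the sphere.\<close>

definition ip :: "('a::euclidean_space \<Rightarrow> real) \<Rightarrow> ('a \<Rightarrow> real) \<Rightarrow> real" where
  "ip f g = (\<integral>x. f x * g x \<partial>sphere_measure)"

lemma sphere_L2sq_ip: "sphere_L2sq f = ip f f"
  by (simp add: sphere_L2sq_def ip_def power2_eq_square)

lemma ip_commute: "ip f g = ip g f"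
  by (simp add: ip_def mult.commute)

lemma ip_cong:
  assumes "\<And>x. x \<in> sphere 0 1 \<Longrightarrow> f x = f' x" "\<And>x. x \<in> sphere 0 1 \<Longrightarrow> g x = g' x"
    "is_poly f" "is_poly g" "is_poly f'" "is_poly g'"
  shows "ip f g = ip f' g'"
  unfolding ip_def
proof (rule integral_cong_AE)
  show "AE x in sphere_measure. f x * g x = f' x * g' x"
    using AE_sphere_measure by eventually_elim (use assms(1,2) in auto)
qed (use assms(3-6) in \<open>measurable\<close>)

lemma ip_diff_right: "is_poly f \<Longrightarrow> is_poly g \<Longrightarrow> is_poly h \<Longrightarrow> ip f (\<lambda>x. g x - h x) = ip f g - ip f h"
  unfolding ip_def right_diff_distrib
  by (intro Bochner_Integration.integral_diff integrable_is_poly is_poly_mult)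

lemma ip_cmult_right: "ip f (\<lambda>x. c * g x) = c * ip f g"
  unfolding ip_def by (simp add: mult.left_commute)

lemma ip_cmult_left: "ip (\<lambda>x. c * g x) f = c * ip g f"
  using ip_cmult_right ip_commute by metis

lemma ip_sum_right:
  assumes "is_poly f" "\<And>k. k \<in> I \<Longrightarrow> is_poly (g k)"
  shows "ip f (\<lambda>x. \<Sum>k\<in>I. g k x) = (\<Sum>k\<in>I. ip f (g k))"
  unfolding ip_def sum_distrib_left
  by (intro Bochner_Integration.integral_sum integrable_is_poly is_poly_mult assms)

lemma ip_sum_left:
  assumes "is_poly f" "\<And>k. k \<in> I \<Longrightarrow> is_poly (g k)"
  shows "ip (\<lambda>x. \<Sum>k\<in>I. g k x) f = (\<Sum>k\<in>I. ip (g k) f)"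
  using ip_sum_right[OF assms] by (simp add: ip_commute)

lemma ip_nonneg: "ip f f \<ge> 0"
  unfolding ip_def by (intro integral_nonneg_AE) auto

text \<open>A measure-preserving involution is self-adjoint.\<close>

lemma ip_householder:
  assumes f: "is_poly f" and g: "is_poly g"
  shows "ip (\<lambda>x. f (householder w x)) g = ip f (\<lambda>x. g (householder w x))"
proof -
  have [measurable]: "f \<in> borel_measurable borel" "g \<in> borel_measurable borel"
    using assms by (auto intro: is_poly_measurable)
  show ?thesis
    using integral_sphere_householder[of "\<lambda>x. f x * g (householder w x)" w]
    by (simp add: ip_def householder_involution)
qed

lemma open_lborel_null:
  fixes S :: "'a::euclidean_space set"
  assumes "open S" "AE x in lborel. x \<notin> S" shows "S = {}"
proof (rule ccontr)
  assume "S \<noteq> {}"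
  then obtain x e where e: "e > 0" "ball x e \<subseteq> S" using assms(1) open_contains_ball by blast
  have "AE y in lborel. y \<notin> ball x e" using assms(2) by eventually_elim (use e(2) in blast)
  then have "emeasure lborel {y \<in> space lborel. y \<in> ball x e} = 0" by (rule emeasure_eq_0_AE)
  then have "emeasure lborel (ball x e) = 0" by (simp only: space_lborel space_borel UNIV_I simp_thms Collect_mem_eq)
  moreover have "measure lborel (ball x e) > 0" using e(1) by (rule content_ball_pos)
  ultimately show False by (simp add: Sigma_Algebra.measure_def)
qed

text \<open>The surface measure has full support. The points of the punctured ball whose radial
  projection is not a zero of \<open>f\<close> form an open null set, so there are none, and half of
  \<open>x0\<close> is a point of the punctured ball that projects to \<open>x0\<close>.\<close>

lemma ip_eq_0_imp:
  fixes f :: "'a::euclidean_space \<Rightarrow> real"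
  assumes f: "is_poly f" and "ip f f = 0" and x0: "x0 \<in> sphere 0 1"
  shows "f x0 = 0"
proof -
  let ?p = "\<lambda>x::'a. x /\<^sub>R norm x" and ?U = "uniform_measure lborel (ball (0::'a) 1)"
  have [measurable]: "f \<in> borel_measurable borel" using f by (rule is_poly_measurable)
  have "AE x in sphere_measure. f x * f x = 0"
    using assms(2) unfolding ip_def
    by (subst (asm) integral_nonneg_eq_0_iff_AE) (auto intro!: integrable_is_poly is_poly_mult f)
  then have "AE x in ?U. f (?p x) = 0"
    unfolding sphere_measure_def by (subst (asm) AE_distr_iff) auto
  then have ae: "AE x in lborel. x \<in> ball 0 1 \<longrightarrow> f (?p x) = 0"
    using emeasure_unit_ball_pos[where 'a='a] emeasure_lborel_ball_finite[of "0::'a" 1]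
    by (subst (asm) AE_uniform_measure) auto
  define S where "S = {x \<in> ball 0 1 - {0}. f (?p x) \<in> - {0}}"
  have "continuous_on (ball 0 1 - {0}) (\<lambda>x. f (?p x))"
    by (intro continuous_on_compose2[OF is_poly_continuous_on[OF f, of UNIV]] continuous_intros) auto
  then have "open ((ball 0 1 - {0}) \<inter> (\<lambda>x. f (?p x)) -` (- {0}))"
    by (rule continuous_open_preimage) auto
  moreover have "(ball 0 1 - {0}) \<inter> (\<lambda>x. f (?p x)) -` (- {0}) = S" by (auto simp: S_def)
  ultimately have "open S" by (simp only:)
  moreover have "AE x in lborel. x \<notin> S" using ae by (auto simp: S_def elim!: eventually_mono)
  ultimately have "S = {}" by (rule open_lborel_null)
  moreover have "(1/2) *\<^sub>R x0 \<in> ball 0 1 - {0}" "?p ((1/2) *\<^sub>R x0) = x0" using x0 by auto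
  ultimately show ?thesis unfolding S_def by (metis (mono_tags, lifting) ComplI empty_iff mem_Collect_eq singletonD)
qed

section \<open>Reduced monomials\<close>

text \<open>Exponents of the normal forms modulo \<open>|x|^2 = 1\<close>: squares of the coordinate
  along \<open>e\<close> are eliminated in favour of the others.\<close>

definition reduced :: "'a::euclidean_space \<Rightarrow> nat \<Rightarrow> ('a \<Rightarrow> nat) set" where
  "reduced e t = {\<alpha> \<in> multi_indices t. \<alpha> e \<le> 1}"

lemma finite_reduced: "finite (reduced e t)"
  by (simp add: reduced_def finite_multi_indices)

definition red_span :: "'a::euclidean_space \<Rightarrow> nat \<Rightarrow> ('a \<Rightarrow> real) \<Rightarrow> bool" where
  "red_span e s f \<longleftrightarrow> (\<exists>c. \<forall>x\<in>sphere 0 1. f x = (\<Sum>\<beta>\<in>reduced e s. c \<beta> * mfun \<beta> x))"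

lemma red_span_add: "red_span e s f \<Longrightarrow> red_span e s g \<Longrightarrow> red_span e s (\<lambda>x. f x + g x)"
  unfolding red_span_def
proof safe
  fix c d
  assume "\<forall>x\<in>sphere 0 1. f x = (\<Sum>\<beta>\<in>reduced e s. c \<beta> * mfun \<beta> x)"
     "\<forall>x\<in>sphere 0 1. g x = (\<Sum>\<beta>\<in>reduced e s. d \<beta> * mfun \<beta> x)"
  then show "\<exists>c. \<forall>x\<in>sphere 0 1. f x + g x = (\<Sum>\<beta>\<in>reduced e s. c \<beta> * mfun \<beta> x)"
    by (intro exI[of _ "\<lambda>\<beta>. c \<beta> + d \<beta>"]) (simp add: distrib_right sum.distrib)
qed

lemma red_span_cmult: "red_span e s f \<Longrightarrow> red_span e s (\<lambda>x. a * f x)"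
  unfolding red_span_def
proof safe
  fix c
  assume "\<forall>x\<in>sphere 0 1. f x = (\<Sum>\<beta>\<in>reduced e s. c \<beta> * mfun \<beta> x)"
  then show "\<exists>c. \<forall>x\<in>sphere 0 1. a * f x = (\<Sum>\<beta>\<in>reduced e s. c \<beta> * mfun \<beta> x)"
    by (intro exI[of _ "\<lambda>\<beta>. a * c \<beta>"]) (simp add: mult.assoc sum_distrib_left)
qed

lemma red_span_zero: "red_span e s (\<lambda>x. 0)"
  unfolding red_span_def by (intro exI[of _ "\<lambda>_. 0"]) simp

lemma red_span_sum: "(\<And>i. i \<in> I \<Longrightarrow> red_span e s (f i)) \<Longrightarrow> red_span e s (\<lambda>x. \<Sum>i\<in>I. f i x)"
  by (induction I rule: infinite_finite_induct) (auto intro: red_span_zero red_span_add)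

lemma red_span_cong: "red_span e s f \<Longrightarrow> (\<And>x. x \<in> sphere 0 1 \<Longrightarrow> g x = f x) \<Longrightarrow> red_span e s g"
  unfolding red_span_def by auto

text \<open>Replacing one factor \<open>(x \<bullet> e)^2\<close> by 1 minus the other squares
  lowers the exponent of \<open>e\<close> by 2 and does not raise the total degree.\<close>

lemma red_span_mfun:
  fixes e :: "'a::euclidean_space"
  assumes e: "e \<in> Basis" and "\<alpha> \<in> multi_indices s"
  shows "red_span e s (mfun \<alpha>)"
  using assms(2)
proof (induction "\<alpha> e" arbitrary: \<alpha> rule: less_induct)
  case less
  show ?case
  proof (cases "\<alpha> e \<le> 1")
    case True
    then have "\<alpha> \<in> reduced e s" using less by (simp add: reduced_def)
    then show ?thesis
      unfolding red_span_def
      by (intro exI[of _ "\<lambda>\<beta>. if \<beta> = \<alpha> then 1 else 0"])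
         (auto simp: if_distrib[of "\<lambda>c. c * _"] finite_reduced cong: if_cong)
  next
    case False
    let ?\<alpha>0 = "\<alpha>(e := \<alpha> e - 2)"
    have sum_e: "sum \<beta> Basis = \<beta> e + sum \<beta> (Basis - {e})" for \<beta> :: "'a \<Rightarrow> nat"
      using e by (simp add: sum.remove)
    have s0: "\<alpha> e + sum \<alpha> (Basis - {e}) \<le> s"
      using less(2) sum_e[of \<alpha>] by (simp add: multi_indices_def)
    have "sum ?\<alpha>0 (Basis - {e}) = sum \<alpha> (Basis - {e})" by (rule sum.cong) auto
    then have s1: "sum ?\<alpha>0 Basis + 2 \<le> s" using s0 sum_e[of ?\<alpha>0] False by simp
    then have m0: "?\<alpha>0 \<in> multi_indices s" using less(2) e by (auto simp: multi_indices_def)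
    have mi: "?\<alpha>0(i := ?\<alpha>0 i + 2) \<in> multi_indices s" if "i \<in> Basis - {e}" for i
    proof -
      have "sum (?\<alpha>0(i := ?\<alpha>0 i + 2)) Basis = ?\<alpha>0 i + 2 + sum (?\<alpha>0(i := ?\<alpha>0 i + 2)) (Basis - {i})"
        using that by (subst sum.remove[of _ i]) auto
      also have "sum (?\<alpha>0(i := ?\<alpha>0 i + 2)) (Basis - {i}) = sum ?\<alpha>0 (Basis - {i})"
        by (rule sum.cong) auto
      also have "?\<alpha>0 i + 2 + sum ?\<alpha>0 (Basis - {i}) = sum ?\<alpha>0 Basis + 2"
        using that sum.remove[of Basis i ?\<alpha>0] by simp
      finally have "sum (?\<alpha>0(i := ?\<alpha>0 i + 2)) Basis \<le> s" using s1 by (simp only:)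
      moreover have "(?\<alpha>0(i := ?\<alpha>0 i + 2)) j = 0" if "j \<notin> Basis" for j
        using less(2) that \<open>i \<in> Basis - {e}\<close> e by (auto simp: multi_indices_def)
      ultimately show ?thesis unfolding multi_indices_def by blast
    qed
    have up: "mfun (\<beta>(i := \<beta> i + 2)) x = (x \<bullet> i)\<^sup>2 * mfun \<beta> x" if "i \<in> Basis" for \<beta> i and x :: 'a
    proof -
      have "mfun (\<beta>(i := \<beta> i + 2)) x = (x \<bullet> i) ^ (\<beta> i + 2) * (\<Prod>j\<in>Basis - {i}. (x \<bullet> j) ^ \<beta> j)"
        unfolding mfun_def using that by (subst prod.remove[of _ i]) (auto intro!: prod.cong)
      moreover have "mfun \<beta> x = (x \<bullet> i) ^ \<beta> i * (\<Prod>j\<in>Basis - {i}. (x \<bullet> j) ^ \<beta> j)"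
        unfolding mfun_def using that by (subst prod.remove[of _ i]) auto
      ultimately show ?thesis by (simp add: power2_eq_square)
    qed
    have "red_span e s (\<lambda>x. mfun ?\<alpha>0 x + (-1) * (\<Sum>i\<in>Basis - {e}. mfun (?\<alpha>0(i := ?\<alpha>0 i + 2)) x))"
      using False by (intro red_span_add red_span_cmult red_span_sum less(1) m0 mi) auto
    then show ?thesis
    proof (rule red_span_cong)
      fix x :: 'a assume "x \<in> sphere 0 1"
      then have "1 = (x \<bullet> e)\<^sup>2 + (\<Sum>i\<in>Basis - {e}. (x \<bullet> i)\<^sup>2)"
        using e euclidean_inner[of x x] by (simp add: dot_square_norm power2_eq_square sum.remove)
      then have "(x \<bullet> e)\<^sup>2 = 1 - (\<Sum>i\<in>Basis - {e}. (x \<bullet> i)\<^sup>2)" by simp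
      moreover have "mfun \<alpha> x = (x \<bullet> e)\<^sup>2 * mfun ?\<alpha>0 x"
        using up[OF e, of ?\<alpha>0 x] False by (simp add: fun_upd_idem)
      moreover have "(\<Sum>i\<in>Basis - {e}. mfun (?\<alpha>0(i := ?\<alpha>0 i + 2)) x) =
          (\<Sum>i\<in>Basis - {e}. (x \<bullet> i)\<^sup>2 * mfun ?\<alpha>0 x)"
        by (intro sum.cong refl up) simp
      ultimately show "mfun \<alpha> x = mfun ?\<alpha>0 x + (-1) * (\<Sum>i\<in>Basis - {e}. mfun (?\<alpha>0(i := ?\<alpha>0 i + 2)) x)"
        by (simp only: sum_distrib_right left_diff_distrib)
    qed
  qed
qed

lemma red_span_poly: "e \<in> Basis \<Longrightarrow> poly_deg_le s f \<Longrightarrow> red_span e s f"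
  by (rotate_tac, induction rule: poly_deg_le_induct)
     (auto intro: red_span_mfun red_span_zero red_span_add red_span_cmult)

subsection \<open>Linear independence on the sphere\<close>

text \<open>Induction over the variables. Freezing all but \<open>b\<close> leaves a polynomial in
  one variable with infinitely many roots, so its coefficients vanish at every point of the smaller
  box. Passing to \<open>G (\<alpha> b)\<close> preserves the assumption that exponents are
  determined by their values on the variables still in play.\<close>

lemma polynomial_vanishing_on_box:
  fixes c :: "('b \<Rightarrow> nat) \<Rightarrow> real"
  assumes "finite B" "finite F" "\<delta> > 0"
    and "\<And>\<alpha> \<beta>. \<alpha> \<in> F \<Longrightarrow> \<beta> \<in> F \<Longrightarrow> (\<forall>i\<in>B. \<alpha> i = \<beta> i) \<Longrightarrow> \<alpha> = \<beta>"
    and "\<And>y. (\<forall>i\<in>B. 0 < y i \<and> y i < \<delta>) \<Longrightarrow> (\<Sum>\<alpha>\<in>F. c \<alpha> * (\<Prod>i\<in>B. y i ^ \<alpha> i)) = 0"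
    and "\<alpha> \<in> F"
  shows "c \<alpha> = 0"
  using assms(1,2,4-6)
proof (induction B arbitrary: F rule: finite_induct)
  case empty
  then have "F = {\<alpha>}" by blast
  then show ?case using empty(3) by simp
next
  case (insert b B)
  define G where "G k = {\<beta> \<in> F. \<beta> b = k}" for k
  define n where "n = Max ((\<lambda>\<beta>. \<beta> b) ` F)"
  have le_n: "\<beta> b \<le> n" if "\<beta> \<in> F" for \<beta> using that insert(4) by (simp add: n_def)
  show ?case
  proof (rule insert.IH[of "G (\<alpha> b)"])
    show "finite (G (\<alpha> b))" using insert(4) by (simp add: G_def)
    show "\<alpha> \<in> G (\<alpha> b)" using insert by (simp add: G_def)
    show "\<beta> = \<beta>'" if "\<beta> \<in> G (\<alpha> b)" "\<beta>' \<in> G (\<alpha> b)" "\<forall>i\<in>B. \<beta> i = \<beta>' i" for \<beta> \<beta>'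
      using that by (intro insert(5)) (auto simp: G_def)
    fix y :: "'b \<Rightarrow> real" assume y: "\<forall>i\<in>B. 0 < y i \<and> y i < \<delta>"
    define q where "q k = (\<Sum>\<beta>\<in>G k. c \<beta> * (\<Prod>i\<in>B. y i ^ \<beta> i))" for k
    have "(\<Sum>k\<le>n. q k * z ^ k) = 0" if "z \<in> {0<..<\<delta>}" for z
    proof -
      have "(\<Sum>k\<le>n. q k * z ^ k) = (\<Sum>k\<le>n. \<Sum>\<beta>\<in>{\<beta> \<in> F. \<beta> b = k}. c \<beta> * (z ^ \<beta> b * (\<Prod>i\<in>B. y i ^ \<beta> i)))"
        by (auto simp: q_def G_def sum_distrib_right intro!: sum.cong)
      also have "\<dots> = (\<Sum>\<beta>\<in>F. c \<beta> * (z ^ \<beta> b * (\<Prod>i\<in>B. y i ^ \<beta> i)))"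
        by (rule sum.group) (auto simp: insert(4) le_n)
      also have "\<dots> = (\<Sum>\<beta>\<in>F. c \<beta> * (\<Prod>i\<in>insert b B. (y(b := z)) i ^ \<beta> i))"
      proof (intro sum.cong refl arg_cong2[where f="(*)"])
        fix \<beta> :: "'b \<Rightarrow> nat"
        have "(\<Prod>i\<in>B. (y(b := z)) i ^ \<beta> i) = (\<Prod>i\<in>B. y i ^ \<beta> i)"
          using insert(2) by (intro prod.cong) auto
        then show "z ^ \<beta> b * (\<Prod>i\<in>B. y i ^ \<beta> i) = (\<Prod>i\<in>insert b B. (y(b := z)) i ^ \<beta> i)"
          using insert(1,2) by simp
      qed
      also have "\<dots> = 0" using y that by (intro insert(6)) auto
      finally show ?thesis .
    qed
    then have "{0<..<\<delta>} \<subseteq> {z. (\<Sum>k\<le>n. q k * z ^ k) = 0}" by blast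
    moreover have "infinite {0<..<\<delta>}" using assms(3) by simp
    ultimately have "infinite {z. (\<Sum>k\<le>n. q k * z ^ k) = 0}" using finite_subset by blast
    then have "q (\<alpha> b) = 0" using polyfun_finite_roots[of q n] le_n[OF insert(7)] by blast
    then show "(\<Sum>\<beta>\<in>G (\<alpha> b). c \<beta> * (\<Prod>i\<in>B. y i ^ \<beta> i)) = 0" by (simp add: q_def)
  qed
qed

text \<open>Reflecting in \<open>e\<close> separates the exponents \<open>0\<close> and \<open>1\<close> of \<open>e\<close>; the remaining coordinates vary
  over an open set.\<close>

lemma reduced_independent:
  fixes e :: "'a::euclidean_space"
  assumes e: "e \<in> Basis" and F: "F \<subseteq> reduced e t"
    and van: "\<And>x. x \<in> sphere 0 1 \<Longrightarrow> (\<Sum>\<alpha>\<in>F. c \<alpha> * mfun \<alpha> x) = 0"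
    and \<alpha>: "\<alpha> \<in> F"
  shows "c \<alpha> = 0"
proof -
  let ?B = "Basis - {e}"
  define F' where "F' k = {\<beta> \<in> F. \<beta> e = k}" for k :: nat
  \<comment> \<open>Small enough that the squares of the remaining coordinates sum to less than 1,
    which leaves a positive height \<open>h\<close> along \<open>e\<close>.\<close>
  define \<delta> where "\<delta> = 1 / real DIM('a)"
  define S where "S k y = (\<Sum>\<beta>\<in>F' k. c \<beta> * (\<Prod>i\<in>?B. y i ^ \<beta> i))" for k and y :: "'a \<Rightarrow> real"
  have finF: "finite F" using F finite_reduced finite_subset by blast
  have F01: "F = F' 0 \<union> F' 1" "F' 0 \<inter> F' 1 = {}" using F by (auto simp: F'_def reduced_def le_Suc_eq)
  have finF': "finite (F' k)" for k using finF by (simp add: F'_def)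
  have \<delta>: "\<delta> > 0" by (simp add: \<delta>_def)
  have zero: "S 0 y = 0 \<and> S 1 y = 0" if y: "\<forall>i\<in>?B. 0 < y i \<and> y i < \<delta>" for y
  proof -
    have "(y i)\<^sup>2 \<le> \<delta>" if "i \<in> ?B" for i
    proof -
      have "y i < \<delta>" "0 < y i" using y that by auto
      moreover have "\<delta> \<le> 1" using DIM_positive[where 'a='a] by (simp add: \<delta>_def)
      ultimately have "y i * y i \<le> y i * 1" by (intro mult_left_mono) auto
      then show ?thesis using \<open>y i < \<delta>\<close> by (simp add: power2_eq_square)
    qed
    then have "(\<Sum>i\<in>?B. (y i)\<^sup>2) \<le> real (card ?B) * \<delta>" by (rule sum_bounded_above)
    also have "\<dots> < 1"
      using e DIM_positive[where 'a='a] by (simp add: \<delta>_def field_simps card_Diff_singleton)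
    finally have lt1: "(\<Sum>i\<in>?B. (y i)\<^sup>2) < 1" .
    define h where "h = sqrt (1 - (\<Sum>i\<in>?B. (y i)\<^sup>2))"
    have h: "h > 0" "h\<^sup>2 = 1 - (\<Sum>i\<in>?B. (y i)\<^sup>2)" using lt1 by (auto simp: h_def)
    have *: "S 0 y + \<sigma> * h * S 1 y = 0" if "\<sigma>\<^sup>2 = 1" for \<sigma>
    proof -
      define x where "x = (\<Sum>i\<in>Basis. (if i = e then \<sigma> * h else y i) *\<^sub>R i)"
      have xi: "x \<bullet> i = (if i = e then \<sigma> * h else y i)" if "i \<in> Basis" for i
        unfolding x_def using that by (rule inner_sum_left_Basis)
      have xb: "(\<Prod>i\<in>?B. (x \<bullet> i) ^ \<beta> i) = (\<Prod>i\<in>?B. y i ^ \<beta> i)" for \<beta> :: "'a \<Rightarrow> nat"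
        by (rule prod.cong) (auto simp: xi)
      have "x \<bullet> x = (\<Sum>i\<in>Basis. (x \<bullet> i)\<^sup>2)" using euclidean_inner[of x x] by (simp add: power2_eq_square)
      also have "\<dots> = (\<sigma> * h)\<^sup>2 + (\<Sum>i\<in>?B. (y i)\<^sup>2)"
        using e by (subst sum.remove[of _ e]) (auto simp: xi intro!: sum.cong)
      also have "\<dots> = 1" using that h by (simp add: power_mult_distrib)
      finally have "x \<in> sphere 0 1" by (simp add: norm_eq_1)
      then have "0 = (\<Sum>\<beta>\<in>F. c \<beta> * mfun \<beta> x)" using van by simp
      also have "\<dots> = (\<Sum>\<beta>\<in>F' 0. c \<beta> * mfun \<beta> x) + (\<Sum>\<beta>\<in>F' 1. c \<beta> * mfun \<beta> x)"
        by (subst F01(1), rule sum.union_disjoint[OF finF' finF' F01(2)])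
      also have "(\<Sum>\<beta>\<in>F' 0. c \<beta> * mfun \<beta> x) = S 0 y"
        unfolding S_def mfun_def using e by (intro sum.cong refl) (auto simp: prod.remove xb F'_def)
      also have "(\<Sum>\<beta>\<in>F' 1. c \<beta> * mfun \<beta> x) = \<sigma> * h * S 1 y"
        unfolding S_def mfun_def sum_distrib_left using e by (intro sum.cong refl) (auto simp: prod.remove xb xi F'_def)
      finally show ?thesis by simp
    qed
    from *[of 1] *[of "-1"] h show ?thesis by auto
  qed
  have "\<exists>k. \<alpha> \<in> F' k \<and> (\<forall>y. (\<forall>i\<in>?B. 0 < y i \<and> y i < \<delta>) \<longrightarrow> S k y = 0)"
    using \<alpha> zero F01(1) by auto
  then obtain k where k: "\<alpha> \<in> F' k" "\<And>y. (\<forall>i\<in>?B. 0 < y i \<and> y i < \<delta>) \<Longrightarrow> S k y = 0" by blast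
  show ?thesis
  proof (rule polynomial_vanishing_on_box[of ?B "F' k" \<delta> c])
    fix \<beta> \<beta>' assume a: "\<beta> \<in> F' k" "\<beta>' \<in> F' k" "\<forall>i\<in>?B. \<beta> i = \<beta>' i"
    show "\<beta> = \<beta>'"
    proof
      fix i show "\<beta> i = \<beta>' i"
      proof (cases "i \<in> ?B")
        case False
        have "\<beta> \<in> multi_indices t" "\<beta>' \<in> multi_indices t" using a F by (auto simp: F'_def reduced_def)
        with False a show ?thesis by (cases "i = e") (auto simp: F'_def multi_indices_def)
      qed (use a in blast)
    qed
  qed (use k finF' \<delta> in \<open>auto simp: S_def\<close>)
qed

subsection \<open>Counting\<close>

text \<open>The set of variables is a parameter because the count proceeds by induction on it and is
  applied to \<open>Basis - {e}\<close>.\<close>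

definition bounded_indices :: "'b set \<Rightarrow> nat \<Rightarrow> ('b \<Rightarrow> nat) set" where
  "bounded_indices B t = {\<alpha>. (\<forall>i. i \<notin> B \<longrightarrow> \<alpha> i = 0) \<and> sum \<alpha> B \<le> t}"

lemma finite_bounded_indices:
  assumes "finite B" shows "finite (bounded_indices B t)"
proof (rule finite_subset)
  show "bounded_indices B t \<subseteq> {f. \<forall>x. (x \<in> B \<longrightarrow> f x \<in> {..t}) \<and> (x \<notin> B \<longrightarrow> f x = 0)}"
  proof safe
    fix \<alpha> i assume "\<alpha> \<in> bounded_indices B t" "i \<in> B"
    then show "\<alpha> i \<le> t"
      using member_le_sum[of i B \<alpha>] assms by (auto simp: bounded_indices_def)
  qed (auto simp: bounded_indices_def)
  show "finite {f. \<forall>x. (x \<in> B \<longrightarrow> f x \<in> {..t}) \<and> (x \<notin> B \<longrightarrow> f x = (0::nat))}"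
    using assms by (rule finite_set_of_finite_funs) auto
qed

text \<open>Pascal's rule: either the exponent of \<open>b\<close> is 0, or lowering it by 1 gives
  an index whose total is bounded by one less.\<close>

lemma card_bounded_indices:
  assumes "finite B" shows "card (bounded_indices B t) = (card B + t) choose t"
  using assms
proof (induction B arbitrary: t rule: finite_induct)
  case empty
  have "bounded_indices {} t = {\<lambda>_::'a. 0}" by (auto simp: bounded_indices_def)
  then show ?case by simp
next
  case (insert b B)
  have sumins: "sum \<alpha> (insert b B) = \<alpha> b + sum \<alpha> B" for \<alpha> :: "'a \<Rightarrow> nat" using insert by simp
  have upd: "sum (\<alpha>(b := k)) B = sum \<alpha> B" for \<alpha> :: "'a \<Rightarrow> nat" and k
    using insert by (intro sum.cong) auto
  show ?case
  proof (induction t)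
    case 0
    have "bounded_indices (insert b B) 0 = {\<lambda>_. 0}"
    proof (intro equalityI subsetI)
      fix \<alpha> assume "\<alpha> \<in> bounded_indices (insert b B) 0"
      then have "\<alpha> i = 0" for i using insert(1) by (cases "i \<in> insert b B") (auto simp: bounded_indices_def)
      then show "\<alpha> \<in> {\<lambda>_. 0}" by auto
    qed (auto simp: bounded_indices_def)
    then show ?case by simp
  next
    case (Suc t)
    let ?up = "\<lambda>\<alpha>. \<alpha>(b := Suc (\<alpha> b))"
    have eq: "bounded_indices (insert b B) (Suc t) = bounded_indices B (Suc t) \<union> ?up ` bounded_indices (insert b B) t"
    proof (intro equalityI subsetI)
      fix \<alpha> assume a: "\<alpha> \<in> bounded_indices (insert b B) (Suc t)"
      show "\<alpha> \<in> bounded_indices B (Suc t) \<union> ?up ` bounded_indices (insert b B) t"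
      proof (cases "\<alpha> b")
        case 0
        then show ?thesis using a by (auto simp: bounded_indices_def sumins) (metis)
      next
        case (Suc k)
        have "sum (\<alpha>(b := k)) (insert b B) \<le> t"
          using a Suc unfolding sumins upd by (simp add: bounded_indices_def sumins)
        moreover have "(\<alpha>(b := k)) i = 0" if "i \<notin> insert b B" for i
          using a that by (simp add: bounded_indices_def)
        ultimately have "\<alpha>(b := k) \<in> bounded_indices (insert b B) t"
          unfolding bounded_indices_def by blast
        moreover have "\<alpha> = ?up (\<alpha>(b := k))" using Suc by auto
        ultimately show ?thesis by blast
      qed
    next
      fix \<alpha> assume "\<alpha> \<in> bounded_indices B (Suc t) \<union> ?up ` bounded_indices (insert b B) t"
      then show "\<alpha> \<in> bounded_indices (insert b B) (Suc t)"
      proof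
        assume "\<alpha> \<in> ?up ` bounded_indices (insert b B) t"
        then obtain \<beta> where \<beta>: "\<alpha> = ?up \<beta>" "\<beta> \<in> bounded_indices (insert b B) t" by blast
        then have "sum \<alpha> (insert b B) \<le> Suc t"
          unfolding sumins \<beta>(1) upd by (simp add: bounded_indices_def sumins)
        then show ?thesis using \<beta> by (auto simp: bounded_indices_def)
      qed (use insert(2) in \<open>auto simp: bounded_indices_def sumins\<close>)
    qed
    have disj: "bounded_indices B (Suc t) \<inter> ?up ` bounded_indices (insert b B) t = {}"
      using insert(2) by (auto simp: bounded_indices_def)
    have inj: "inj_on ?up (bounded_indices (insert b B) t)"
    proof (rule inj_onI)
      fix \<alpha> \<beta> :: "'a \<Rightarrow> nat" assume "?up \<alpha> = ?up \<beta>"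
      then show "\<alpha> = \<beta>" by (auto simp: fun_eq_iff split: if_splits)
    qed
    have "card (bounded_indices (insert b B) (Suc t)) =
        (card B + Suc t choose Suc t) + (card (insert b B) + t choose t)"
      unfolding eq using insert disj Suc
      by (subst card_Un_disjoint) (auto simp: finite_bounded_indices card_image[OF inj])
    then show ?case using insert by simp
  qed
qed

text \<open>The summands count exponent 0 and exponent 1 along \<open>e\<close>; they are the two
  binomials of \<open>dim_Pi\<close>.\<close>

lemma card_reduced_Suc:
  fixes e :: "'a::euclidean_space"
  assumes e: "e \<in> Basis" and d: "DIM('a) = Suc d"
  shows "card (reduced e (Suc t)) = ((d + Suc t) choose Suc t) + ((d + t) choose t)"
proof -
  let ?B = "Basis - {e}"
  have cB: "card ?B = d" using e d by simp
  have sume: "sum \<alpha> Basis = \<alpha> e + sum \<alpha> ?B" for \<alpha> :: "'a \<Rightarrow> nat" using e by (simp add: sum.remove)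
  have upd: "sum (\<alpha>(e := k)) ?B = sum \<alpha> ?B" for \<alpha> :: "'a \<Rightarrow> nat" and k by (intro sum.cong) auto
  let ?up = "\<lambda>\<alpha>::'a \<Rightarrow> nat. \<alpha>(e := Suc 0)"
  have eq: "reduced e (Suc t) = bounded_indices ?B (Suc t) \<union> ?up ` bounded_indices ?B t"
  proof (intro equalityI subsetI)
    fix \<alpha> assume a: "\<alpha> \<in> reduced e (Suc t)"
    then have "\<alpha> e = 0 \<or> \<alpha> e = 1" by (auto simp: reduced_def)
    then show "\<alpha> \<in> bounded_indices ?B (Suc t) \<union> ?up ` bounded_indices ?B t"
    proof
      assume "\<alpha> e = 0"
      then show ?thesis using a by (auto simp: reduced_def multi_indices_def bounded_indices_def sume)
    next
      assume 1: "\<alpha> e = 1"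
      then have "\<alpha>(e := 0) \<in> bounded_indices ?B t"
        using a by (auto simp: reduced_def multi_indices_def bounded_indices_def sume upd)
      moreover have "\<alpha> = ?up (\<alpha>(e := 0))" using 1 by auto
      ultimately show ?thesis by blast
    qed
  next
    fix \<alpha> assume "\<alpha> \<in> bounded_indices ?B (Suc t) \<union> ?up ` bounded_indices ?B t"
    then show "\<alpha> \<in> reduced e (Suc t)"
      using e by (auto simp: reduced_def multi_indices_def bounded_indices_def sume upd)
  qed
  have disj: "bounded_indices ?B (Suc t) \<inter> ?up ` bounded_indices ?B t = {}"
    by (auto simp: bounded_indices_def)
  have inj: "inj_on ?up (bounded_indices ?B t)"
  proof (rule inj_onI)
    fix \<alpha> \<beta> assume a: "\<alpha> \<in> bounded_indices ?B t" "\<beta> \<in> bounded_indices ?B t" "?up \<alpha> = ?up \<beta>"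
    show "\<alpha> = \<beta>"
    proof
      fix i show "\<alpha> i = \<beta> i"
        using a(1,2) fun_cong[OF a(3), of i] by (cases "i = e") (auto simp: bounded_indices_def)
    qed
  qed
  show ?thesis
    unfolding eq using disj
    by (subst card_Un_disjoint) (simp_all add: finite_bounded_indices card_image[OF inj] card_bounded_indices cB)
qed

lemma reduced_0: "reduced e 0 = {\<lambda>_. 0}"
  by (auto simp: reduced_def multi_indices_def fun_eq_iff)

lemma binomial_Suc_real: "real (Suc t) * real ((d + Suc t) choose Suc t) = real (d + Suc t) * real ((d + t) choose t)"
  using Suc_times_binomial_eq[of "d + t" t] by (metis add_Suc_right mult.commute of_nat_mult)

text \<open>Both sizes are expressed through the same binomial coefficient; eliminating it gives the
  ratio of consecutive dimensions used in the next summation.\<close>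

lemma card_reduced_step:
  fixes e :: "'a::euclidean_space"
  assumes e: "e \<in> Basis" and d: "DIM('a) = Suc d"
  shows "(real t + 1) * real (card (reduced e (Suc t))) = (real d + 2 * real t + 2) * real ((d + t) choose t)"
    and "(real t + real d) * real (card (reduced e t)) = (real d + 2 * real t) * real ((d + t) choose t)"
proof -
  show *: "(real t + 1) * real (card (reduced e (Suc t))) = (real d + 2 * real t + 2) * real ((d + t) choose t)" for t
    using binomial_Suc_real[of t d] by (simp add: card_reduced_Suc[OF assms] algebra_simps del: binomial_Suc_Suc)
  show "(real t + real d) * real (card (reduced e t)) = (real d + 2 * real t) * real ((d + t) choose t)"
  proof (cases t)
    case (Suc s)
    have "(real s + 1) * ((real t + real d) * real (card (reduced e t))) =
        (real t + real d) * ((real d + 2 * real s + 2) * real ((d + s) choose s))"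
      using *[of s] by (simp add: Suc algebra_simps)
    also have "\<dots> = (real s + 1) * ((real d + 2 * real t) * real ((d + t) choose t))"
      using binomial_Suc_real[of s d] by (simp add: Suc algebra_simps del: binomial_Suc_Suc)
    finally show ?thesis by (simp add: add_eq_0_iff)
  qed (simp add: reduced_0)
qed

text \<open>The trace of minus the Laplace--Beltrami operator on \<open>Pi_t\<close>, and the origin
  of the factor \<open>t (t + d) / (d + 2)\<close>. From \<open>t\<close> to \<open>t + 1\<close>
  every new index contributes \<open>(t + 1) (t + d)\<close>, and the ratio from
  \<open>card_reduced_step\<close> closes the recursion.\<close>

lemma sum_reduced_eigenvalues:
  fixes e :: "'a::euclidean_space"
  assumes e: "e \<in> Basis" and d: "DIM('a) = Suc d"
  shows "(real d + 2) * (\<Sum>\<alpha>\<in>reduced e t. real (sum \<alpha> Basis) * (real (sum \<alpha> Basis) + real d - 1)) =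
    real (card (reduced e t)) * real t * (real t + real d) * real d"
proof (induction t)
  case 0
  then show ?case by (simp add: reduced_0)
next
  case (Suc t)
  let ?g = "\<lambda>\<alpha>::'a \<Rightarrow> nat. real (sum \<alpha> Basis) * (real (sum \<alpha> Basis) + real d - 1)"
  define N where "N = real (card (reduced e t))"
  define N' where "N' = real (card (reduced e (Suc t)))"
  have sub: "reduced e t \<subseteq> reduced e (Suc t)" by (auto simp: reduced_def multi_indices_def)
  have "sum ?g (reduced e (Suc t) - reduced e t) =
      (\<Sum>\<alpha>\<in>reduced e (Suc t) - reduced e t. (real t + 1) * (real t + real d))"
  proof (rule sum.cong)
    fix \<alpha> assume "\<alpha> \<in> reduced e (Suc t) - reduced e t"
    then have "sum \<alpha> Basis = Suc t" by (auto simp: reduced_def multi_indices_def)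
    then show "?g \<alpha> = (real t + 1) * (real t + real d)" by (simp add: algebra_simps)
  qed simp
  also have "\<dots> = (N' - N) * ((real t + 1) * (real t + real d))"
    using card_mono[OF finite_reduced sub]
    by (simp add: N_def N'_def card_Diff_subset[OF finite_reduced sub] of_nat_diff)
  finally have "sum ?g (reduced e (Suc t)) = (N' - N) * ((real t + 1) * (real t + real d)) + sum ?g (reduced e t)"
    using sum.subset_diff[OF sub finite_reduced, of ?g] by simp
  then have "(real d + 2) * sum ?g (reduced e (Suc t)) =
      (real d + 2) * ((N' - N) * ((real t + 1) * (real t + real d))) + N * real t * (real t + real d) * real d"
    using Suc by (simp add: distrib_left N_def)
  moreover have "(real t + 1) * N' * (real d + 2 * real t) = (real t + real d) * N * (real d + 2 * real t + 2)"
    using card_reduced_step[OF assms, of t] by (simp add: N_def N'_def)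
  ultimately show ?case unfolding N'_def[symmetric] by (simp add: algebra_simps)
qed

section \<open>Orthonormal basis adapted to the degree\<close>

lemma is_poly_mfun: "\<alpha> \<in> multi_indices t \<Longrightarrow> is_poly (mfun \<alpha>)"
  by (rule is_polyI[OF poly_deg_le_mfun_I])

text \<open>Exponents are inserted in nondecreasing order of degree, so orthogonalising against the
  earlier elements keeps the degree of the new one. The third conjunct makes linear independence of
  monomials applicable in the induction; the last one, a triangular inverse, shows later that low
  degrees use only low basis elements.\<close>

lemma gram_schmidt_reduced:
  fixes e :: "'a::euclidean_space"
  assumes e: "e \<in> Basis" and S: "S \<subseteq> reduced e t"
  shows "\<exists>b :: ('a \<Rightarrow> nat) \<Rightarrow> 'a \<Rightarrow> real.
    (\<forall>\<alpha>\<in>S. poly_deg_le (sum \<alpha> Basis) (b \<alpha>)) \<and>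
    (\<forall>\<alpha>\<in>S. \<forall>\<beta>\<in>S. ip (b \<alpha>) (b \<beta>) = (if \<alpha> = \<beta> then 1 else 0)) \<and>
    (\<forall>\<alpha>\<in>S. \<exists>c. \<forall>x. b \<alpha> x = (\<Sum>\<beta>\<in>S. c \<beta> * mfun \<beta> x)) \<and>
    (\<forall>\<alpha>\<in>S. \<exists>c. (\<forall>\<beta>\<in>S. sum \<beta> Basis > sum \<alpha> Basis \<longrightarrow> c \<beta> = 0) \<and> (\<forall>x. mfun \<alpha> x = (\<Sum>\<beta>\<in>S. c \<beta> * b \<beta> x)))"
    (is "\<exists>b. ?P S b")
proof -
  have "finite S" using S finite_reduced finite_subset by blast
  then show ?thesis using S
  proof (induction S rule: finite_ranking_induct[where f="\<lambda>\<alpha>. sum \<alpha> Basis"])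
    case empty
    then show ?case by simp
  next
    case (insert \<xi> S)
    show ?case
    proof (cases "\<xi> \<in> S")
      case True
      then have "insert \<xi> S = S" by blast
      then show ?thesis using insert(3,4) by (simp only:)
    next
      case \<xi>: False
      have finS: "finite S" by fact
      have "S \<subseteq> reduced e t" using insert(4) by blast
      from insert(3)[OF this] obtain b where b: "?P S b" by (rule exE)
      have b1: "\<And>\<alpha>. \<alpha> \<in> S \<Longrightarrow> poly_deg_le (sum \<alpha> Basis) (b \<alpha>)"
        and b2: "\<And>\<alpha> \<beta>. \<alpha> \<in> S \<Longrightarrow> \<beta> \<in> S \<Longrightarrow> ip (b \<alpha>) (b \<beta>) = (if \<alpha> = \<beta> then 1 else 0)"
        and b3: "\<forall>\<alpha>\<in>S. \<exists>c. \<forall>x. b \<alpha> x = (\<Sum>\<beta>\<in>S. c \<beta> * mfun \<beta> x)"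
        and b4: "\<And>\<alpha>. \<alpha> \<in> S \<Longrightarrow> \<exists>c. (\<forall>\<beta>\<in>S. sum \<beta> Basis > sum \<alpha> Basis \<longrightarrow> c \<beta> = 0) \<and> (\<forall>x. mfun \<alpha> x = (\<Sum>\<beta>\<in>S. c \<beta> * b \<beta> x))"
        using b[THEN conjunct1] b[THEN conjunct2, THEN conjunct1] b[THEN conjunct2, THEN conjunct2, THEN conjunct1]
          b[THEN conjunct2, THEN conjunct2, THEN conjunct2] by simp_all
      obtain C where C: "\<And>\<alpha> x. \<alpha> \<in> S \<Longrightarrow> b \<alpha> x = (\<Sum>\<beta>\<in>S. C \<alpha> \<beta> * mfun \<beta> x)"
        using bchoice[OF b3] by blast
      have \<xi>_mi: "\<xi> \<in> multi_indices (sum \<xi> Basis)"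
        using insert(4) by (auto simp: reduced_def multi_indices_def)
      have pb: "is_poly (b \<alpha>)" if "\<alpha> \<in> S" for \<alpha> using b1[OF that] by (rule is_polyI)
      have p\<xi>: "is_poly (mfun \<xi>)" using \<xi>_mi by (rule is_poly_mfun)
      define a where "a \<beta> = ip (mfun \<xi>) (b \<beta>)" for \<beta>
      define g where "g x = mfun \<xi> x - (\<Sum>\<beta>\<in>S. a \<beta> * b \<beta> x)" for x
      have gdeg: "poly_deg_le (sum \<xi> Basis) g"
        unfolding g_def [abs_def]
        by (intro poly_deg_le_diff poly_deg_le_sum poly_deg_le_cmult poly_deg_le_mfun_I \<xi>_mi
             poly_deg_le_mono[OF b1 insert(2)])
      then have pg: "is_poly g" by (rule is_polyI)
      have gb: "ip (b \<alpha>) g = 0" if "\<alpha> \<in> S" for \<alpha>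
      proof -
        have "ip (b \<alpha>) g = ip (b \<alpha>) (mfun \<xi>) - ip (b \<alpha>) (\<lambda>x. \<Sum>\<beta>\<in>S. a \<beta> * b \<beta> x)"
          unfolding g_def [abs_def] using that by (intro ip_diff_right is_poly_intros p\<xi> pb)
        also have "ip (b \<alpha>) (\<lambda>x. \<Sum>\<beta>\<in>S. a \<beta> * b \<beta> x) = (\<Sum>\<beta>\<in>S. ip (b \<alpha>) (\<lambda>x. a \<beta> * b \<beta> x))"
          using that by (intro ip_sum_right is_poly_intros pb)
        also have "\<dots> = a \<alpha>"
          using that finS by (simp add: ip_cmult_right b2 if_distrib[of "\<lambda>c. _ * c"] cong: if_cong)
        finally show ?thesis by (simp add: a_def ip_commute)
      qed
      define c where "c \<beta> = (if \<beta> = \<xi> then 1 else - (\<Sum>\<alpha>\<in>S. a \<alpha> * C \<alpha> \<beta>))" for \<beta>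
      have g_expand: "g x = (\<Sum>\<beta>\<in>insert \<xi> S. c \<beta> * mfun \<beta> x)" for x
      proof -
        have "(\<Sum>\<alpha>\<in>S. a \<alpha> * b \<alpha> x) = (\<Sum>\<alpha>\<in>S. \<Sum>\<beta>\<in>S. a \<alpha> * C \<alpha> \<beta> * mfun \<beta> x)"
          by (simp add: C sum_distrib_left mult.assoc)
        also have "\<dots> = (\<Sum>\<beta>\<in>S. (\<Sum>\<alpha>\<in>S. a \<alpha> * C \<alpha> \<beta>) * mfun \<beta> x)"
          by (subst sum.swap) (simp add: sum_distrib_right)
        also have "\<dots> = - (\<Sum>\<beta>\<in>S. c \<beta> * mfun \<beta> x)"
          unfolding sum_negf[symmetric] using \<xi> by (intro sum.cong refl) (auto simp: c_def)
        finally show ?thesis using finS \<xi> by (simp add: g_def c_def[of \<xi>])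
      qed
      \<comment> \<open>Otherwise \<open>g\<close> would vanish on the sphere, although its
        expansion has coefficient 1 at \<open>mfun \<xi>\<close>, against the independence of
        reduced monomials.\<close>
      have "ip g g \<noteq> 0"
      proof
        assume "ip g g = 0"
        have "(\<Sum>\<beta>\<in>insert \<xi> S. c \<beta> * mfun \<beta> x) = 0" if "x \<in> sphere 0 1" for x
          using ip_eq_0_imp[OF pg \<open>ip g g = 0\<close> that] by (simp only: g_expand)
        then have "c \<xi> = 0" by (rule reduced_independent[OF e insert(4)]) simp_all
        then show False by (simp add: c_def)
      qed
      then have gpos: "ip g g > 0" using ip_nonneg[of g] by simp
      define r where "r = sqrt (ip g g)"
      have r: "r > 0" "r * r = ip g g" using gpos by (auto simp: r_def)
      define b' where "b' = b(\<xi> := \<lambda>x. (1 / r) * g x)"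
      have b'S: "b' \<alpha> = b \<alpha>" if "\<alpha> \<in> S" for \<alpha> using that \<xi> by (auto simp: b'_def)
      have b'\<xi>: "b' \<xi> = (\<lambda>x. (1 / r) * g x)" by (simp add: b'_def)
      have 1: "\<forall>\<alpha>\<in>insert \<xi> S. poly_deg_le (sum \<alpha> Basis) (b' \<alpha>)"
        using b1 poly_deg_le_cmult[OF gdeg, of "1 / r"] by (auto simp: b'S b'\<xi>)
      have 2: "\<forall>\<alpha>\<in>insert \<xi> S. \<forall>\<beta>\<in>insert \<xi> S. ip (b' \<alpha>) (b' \<beta>) = (if \<alpha> = \<beta> then 1 else 0)"
      proof -
        have "ip (b' \<xi>) (b' \<xi>) = (1 / r) * ((1 / r) * ip g g)"
          unfolding b'\<xi> by (simp only: ip_cmult_right ip_cmult_left)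
        then have "ip (b' \<xi>) (b' \<xi>) = 1" using r(1) unfolding r(2)[symmetric] by simp
        moreover have "ip (b' \<alpha>) (b' \<xi>) = 0" if "\<alpha> \<in> S" for \<alpha>
          unfolding b'\<xi> using that by (simp only: ip_cmult_right b'S gb mult_zero_right)
        moreover from this have "ip (b' \<xi>) (b' \<alpha>) = 0" if "\<alpha> \<in> S" for \<alpha>
          using that by (simp add: ip_commute[of "b' \<xi>"])
        ultimately show ?thesis using \<xi> b2 by (auto simp: b'S)
      qed
      have 3: "\<forall>\<alpha>\<in>insert \<xi> S. \<exists>c. \<forall>x. b' \<alpha> x = (\<Sum>\<beta>\<in>insert \<xi> S. c \<beta> * mfun \<beta> x)"
      proof
        fix \<alpha> assume "\<alpha> \<in> insert \<xi> S"
        then consider "\<alpha> = \<xi>" | "\<alpha> \<in> S" by blast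
        then show "\<exists>c. \<forall>x. b' \<alpha> x = (\<Sum>\<beta>\<in>insert \<xi> S. c \<beta> * mfun \<beta> x)"
        proof cases
          case 1
          have "b' \<alpha> x = (\<Sum>\<beta>\<in>insert \<xi> S. (1 / r * c \<beta>) * mfun \<beta> x)" for x
            unfolding 1 b'\<xi> g_expand by (simp only: sum_distrib_left mult.assoc)
          then show ?thesis by (intro exI[of _ "\<lambda>\<beta>. 1 / r * c \<beta>"]) blast
        next
          case 2
          then have "b' \<alpha> x = (\<Sum>\<beta>\<in>insert \<xi> S. (if \<beta> = \<xi> then 0 else C \<alpha> \<beta>) * mfun \<beta> x)" for x
            using finS \<xi> by (auto simp: b'S C intro!: sum.cong)
          then show ?thesis by (intro exI[of _ "\<lambda>\<beta>. if \<beta> = \<xi> then 0 else C \<alpha> \<beta>"]) blast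
        qed
      qed
      have 4: "\<forall>\<alpha>\<in>insert \<xi> S. \<exists>c. (\<forall>\<beta>\<in>insert \<xi> S. sum \<beta> Basis > sum \<alpha> Basis \<longrightarrow> c \<beta> = 0) \<and>
          (\<forall>x. mfun \<alpha> x = (\<Sum>\<beta>\<in>insert \<xi> S. c \<beta> * b' \<beta> x))"
      proof
        fix \<alpha> assume "\<alpha> \<in> insert \<xi> S"
        then consider "\<alpha> = \<xi>" | "\<alpha> \<in> S" by blast
        then show "\<exists>c. (\<forall>\<beta>\<in>insert \<xi> S. sum \<beta> Basis > sum \<alpha> Basis \<longrightarrow> c \<beta> = 0) \<and>
            (\<forall>x. mfun \<alpha> x = (\<Sum>\<beta>\<in>insert \<xi> S. c \<beta> * b' \<beta> x))"
        proof cases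
          case 1
          have "mfun \<xi> x = (\<Sum>\<beta>\<in>insert \<xi> S. (if \<beta> = \<xi> then r else a \<beta>) * b' \<beta> x)" for x
          proof -
            have "(\<Sum>\<beta>\<in>S. (if \<beta> = \<xi> then r else a \<beta>) * b' \<beta> x) = (\<Sum>\<beta>\<in>S. a \<beta> * b \<beta> x)"
              using \<xi> by (intro sum.cong) (auto simp: b'S)
            then show ?thesis using finS \<xi> r by (simp add: b'\<xi> g_def)
          qed
          moreover have "\<not> sum \<beta> Basis > sum \<xi> Basis" if "\<beta> \<in> insert \<xi> S" for \<beta>
            using that insert(2) by fastforce
          ultimately show ?thesis unfolding 1 by (intro exI[of _ "\<lambda>\<beta>. if \<beta> = \<xi> then r else a \<beta>"]) blast
        next
          case 2
          from b4[OF 2] obtain c where c: "\<forall>\<beta>\<in>S. sum \<beta> Basis > sum \<alpha> Basis \<longrightarrow> c \<beta> = 0"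
            "\<And>x. mfun \<alpha> x = (\<Sum>\<beta>\<in>S. c \<beta> * b \<beta> x)" by blast
          have "mfun \<alpha> x = (\<Sum>\<beta>\<in>insert \<xi> S. (c(\<xi> := 0)) \<beta> * b' \<beta> x)" for x
            using finS \<xi> by (auto simp: c(2) b'S intro!: sum.cong)
          then show ?thesis using c(1) by (intro exI[of _ "c(\<xi> := 0)"]) auto
        qed
      qed
      show ?thesis by (intro exI[of _ b'] conjI 1 2 3 4)
    qed
  qed
qed

text \<open>One basis serves all degrees \<open>s \<le> t\<close> at once: triangularity confines
  the expansion to \<open>reduced e s\<close>, and orthonormality identifies its
  coefficients.\<close>

lemma orthonormal_basis_exists:
  fixes e :: "'a::euclidean_space"
  assumes e: "e \<in> Basis"
  obtains b :: "('a \<Rightarrow> nat) \<Rightarrow> 'a \<Rightarrow> real"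
  where "\<And>\<alpha>. \<alpha> \<in> reduced e t \<Longrightarrow> poly_deg_le (sum \<alpha> Basis) (b \<alpha>)"
    and "\<And>\<alpha> \<beta>. \<alpha> \<in> reduced e t \<Longrightarrow> \<beta> \<in> reduced e t \<Longrightarrow> ip (b \<alpha>) (b \<beta>) = (if \<alpha> = \<beta> then 1 else 0)"
    and "\<And>s f x. s \<le> t \<Longrightarrow> poly_deg_le s f \<Longrightarrow> x \<in> sphere 0 1 \<Longrightarrow>
           f x = (\<Sum>\<alpha>\<in>reduced e s. ip f (b \<alpha>) * b \<alpha> x)"
proof -
  let ?M = "reduced e t"
  from gram_schmidt_reduced[OF e order.refl, of t] obtain b where b: "(\<forall>\<alpha>\<in>?M. poly_deg_le (sum \<alpha> Basis) (b \<alpha>)) \<and>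
      (\<forall>\<alpha>\<in>?M. \<forall>\<beta>\<in>?M. ip (b \<alpha>) (b \<beta>) = (if \<alpha> = \<beta> then 1 else 0)) \<and>
      (\<forall>\<alpha>\<in>?M. \<exists>c. \<forall>x. b \<alpha> x = (\<Sum>\<beta>\<in>?M. c \<beta> * mfun \<beta> x)) \<and>
      (\<forall>\<alpha>\<in>?M. \<exists>c. (\<forall>\<beta>\<in>?M. sum \<beta> Basis > sum \<alpha> Basis \<longrightarrow> c \<beta> = 0) \<and> (\<forall>x. mfun \<alpha> x = (\<Sum>\<beta>\<in>?M. c \<beta> * b \<beta> x)))" ..
  have b1: "\<And>\<alpha>. \<alpha> \<in> ?M \<Longrightarrow> poly_deg_le (sum \<alpha> Basis) (b \<alpha>)"
    and b2: "\<And>\<alpha> \<beta>. \<alpha> \<in> ?M \<Longrightarrow> \<beta> \<in> ?M \<Longrightarrow> ip (b \<alpha>) (b \<beta>) = (if \<alpha> = \<beta> then 1 else 0)"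
    and b4: "\<forall>\<alpha>\<in>?M. \<exists>c. (\<forall>\<beta>\<in>?M. sum \<beta> Basis > sum \<alpha> Basis \<longrightarrow> c \<beta> = 0) \<and> (\<forall>x. mfun \<alpha> x = (\<Sum>\<beta>\<in>?M. c \<beta> * b \<beta> x))"
    using b[THEN conjunct1] b[THEN conjunct2, THEN conjunct1]
      b[THEN conjunct2, THEN conjunct2, THEN conjunct2] by simp_all
  from bchoice[OF b4] obtain C where
    C0: "\<And>\<alpha> \<beta>. \<alpha> \<in> ?M \<Longrightarrow> \<beta> \<in> ?M \<Longrightarrow> sum \<beta> Basis > sum \<alpha> Basis \<Longrightarrow> C \<alpha> \<beta> = 0"
    and C: "\<And>\<alpha> x. \<alpha> \<in> ?M \<Longrightarrow> mfun \<alpha> x = (\<Sum>\<beta>\<in>?M. C \<alpha> \<beta> * b \<beta> x)" by blast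
  have pb: "is_poly (b \<alpha>)" if "\<alpha> \<in> ?M" for \<alpha> using b1[OF that] by (rule is_polyI)
  have "f x = (\<Sum>\<alpha>\<in>reduced e s. ip f (b \<alpha>) * b \<alpha> x)"
    if st: "s \<le> t" and f: "poly_deg_le s f" and x: "x \<in> sphere 0 1" for s f x
  proof -
    have sub: "reduced e s \<subseteq> ?M" using multi_indices_mono[OF st] by (auto simp: reduced_def)
    from red_span_poly[OF e f] obtain c where
      c: "\<And>x. x \<in> sphere 0 1 \<Longrightarrow> f x = (\<Sum>\<beta>\<in>reduced e s. c \<beta> * mfun \<beta> x)"
      unfolding red_span_def by blast
    define d where "d \<beta> = (\<Sum>\<alpha>\<in>reduced e s. c \<alpha> * C \<alpha> \<beta>)" for \<beta>
    have fd: "f x = (\<Sum>\<beta>\<in>reduced e s. d \<beta> * b \<beta> x)" if x: "x \<in> sphere 0 1" for x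
    proof -
      have "mfun \<alpha> x = (\<Sum>\<beta>\<in>reduced e s. C \<alpha> \<beta> * b \<beta> x)" if "\<alpha> \<in> reduced e s" for \<alpha>
      proof -
        have "C \<alpha> \<beta> = 0" if "\<beta> \<in> ?M - reduced e s" for \<beta>
          using that \<open>\<alpha> \<in> reduced e s\<close> sub
          by (intro C0) (auto simp: reduced_def multi_indices_def)
        then show ?thesis
          using that sub by (subst C) (auto intro!: sum.mono_neutral_right finite_reduced)
      qed
      then have "f x = (\<Sum>\<alpha>\<in>reduced e s. \<Sum>\<beta>\<in>reduced e s. c \<alpha> * C \<alpha> \<beta> * b \<beta> x)"
        by (simp add: c[OF x] sum_distrib_left mult.assoc)
      also have "\<dots> = (\<Sum>\<beta>\<in>reduced e s. d \<beta> * b \<beta> x)"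
        by (subst sum.swap) (simp add: d_def sum_distrib_right)
      finally show ?thesis .
    qed
    have "ip f (b \<alpha>) = d \<alpha>" if "\<alpha> \<in> reduced e s" for \<alpha>
    proof -
      have "ip f (b \<alpha>) = ip (\<lambda>x. \<Sum>\<beta>\<in>reduced e s. d \<beta> * b \<beta> x) (b \<alpha>)"
        using that sub by (intro ip_cong fd is_poly_intros pb is_polyI[OF f]) auto
      also have "\<dots> = (\<Sum>\<beta>\<in>reduced e s. ip (\<lambda>x. d \<beta> * b \<beta> x) (b \<alpha>))"
        using that sub by (intro ip_sum_left is_poly_intros pb) auto
      also have "\<dots> = (\<Sum>\<beta>\<in>reduced e s. d \<beta> * (if \<beta> = \<alpha> then 1 else 0))"
        using that sub by (intro sum.cong refl) (auto simp: ip_cmult_left b2 subset_iff)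
      also have "\<dots> = d \<alpha>"
        using that by (simp add: finite_reduced if_distrib[of "\<lambda>c. _ * c"] cong: if_cong)
      finally show ?thesis .
    qed
    then show ?thesis using fd[OF x] by simp
  qed
  then show ?thesis using that b1 b2 by blast
qed

section \<open>The reproducing kernel\<close>

definition dd :: "('a::euclidean_space \<Rightarrow> real) \<Rightarrow> 'a \<Rightarrow> 'a \<Rightarrow> real" where
  "dd f x v = (\<Sum>i\<in>Basis. (v \<bullet> i) * pd i f x)"

lemma dd_has_derivative: "is_poly f \<Longrightarrow> (f has_derivative dd f x) (at x)"
  using is_poly_has_derivative[of f x] by (simp add: dd_def [abs_def])

lemma dd_scaleR: "dd f x (c *\<^sub>R v) = c * dd f x v"
  by (simp add: dd_def sum_distrib_left mult.assoc)

lemma dd_basis: "i \<in> Basis \<Longrightarrow> dd f x i = pd i f x"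
  by (simp add: dd_def inner_Basis_sum)

lemma dd_rot:
  "i \<in> Basis \<Longrightarrow> j \<in> Basis \<Longrightarrow> dd f x ((x \<bullet> i) *\<^sub>R j - (x \<bullet> j) *\<^sub>R i) = rot i j f x"
  using dd_basis[of j f x] dd_basis[of i f x]
  by (simp add: dd_def rot_def inner_diff_left left_diff_distrib sum_subtractf mult.assoc flip: sum_distrib_left)

definition great_circle :: "'a::euclidean_space \<Rightarrow> 'a \<Rightarrow> real \<Rightarrow> 'a" where
  "great_circle x v s = cos s *\<^sub>R x + sin s *\<^sub>R v"

lemma great_circle_in_sphere:
  assumes "norm x = 1" "norm v = 1" "x \<bullet> v = 0" shows "great_circle x v s \<in> sphere 0 1"
proof -
  have "great_circle x v s \<bullet> great_circle x v s = (cos s)\<^sup>2 * (x \<bullet> x) + (sin s)\<^sup>2 * (v \<bullet> v)"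
    using assms(3) by (simp add: great_circle_def inner_add_left inner_add_right inner_commute power2_eq_square)
  also have "\<dots> = 1" using assms by (simp add: dot_square_norm)
  finally show ?thesis by (simp add: norm_eq_1)
qed

lemma dd_great_circle:
  assumes "is_poly f"
  shows "((\<lambda>s. f (great_circle x v s)) has_real_derivative dd f x v) (at 0)"
proof -
  have "(great_circle x v has_derivative (\<lambda>h. h *\<^sub>R v)) (at 0)"
    unfolding great_circle_def [abs_def]
    by (auto intro!: derivative_eq_intros)
  moreover have "(f has_derivative dd f x) (at (great_circle x v 0))"
    using dd_has_derivative[OF assms] by (simp add: great_circle_def)
  ultimately have "(f \<circ> great_circle x v has_derivative (dd f x \<circ> (\<lambda>h. h *\<^sub>R v))) (at 0)"
    by (rule diff_chain_at)
  moreover have "dd f x \<circ> (\<lambda>h. h *\<^sub>R v) = (*) (dd f x v)"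
    by (auto simp: dd_scaleR)
  ultimately show ?thesis by (simp add: has_field_derivative_def o_def)
qed

text \<open>In a tangent direction the derivative can be computed along a great circle, which stays
  on the sphere.\<close>

lemma dd_const_on_sphere:
  assumes f: "is_poly f" and k: "\<And>y. y \<in> sphere 0 1 \<Longrightarrow> f y = k" and x: "x \<in> sphere 0 1" and v: "x \<bullet> v = 0"
  shows "dd f x v = 0"
proof (cases "v = 0")
  case False
  let ?u = "v /\<^sub>R norm v"
  have "great_circle x ?u s \<in> sphere 0 1" for s
    using x v False by (intro great_circle_in_sphere) auto
  then have "(\<lambda>s. f (great_circle x ?u s)) = (\<lambda>s. k)" using k by blast
  then have "((\<lambda>s. k) has_real_derivative dd f x ?u) (at 0)"
    using dd_great_circle[OF f, of x ?u] by simp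
  then have "dd f x ?u = 0" using DERIV_const DERIV_unique by blast
  then show ?thesis using False by (simp add: dd_scaleR)
qed (simp add: dd_def)

lemma rot_const_on_sphere:
  assumes "is_poly f" "\<And>y. y \<in> sphere 0 1 \<Longrightarrow> f y = k" "x \<in> sphere 0 1" "i \<in> Basis" "j \<in> Basis"
  shows "rot i j f x = 0"
  using dd_const_on_sphere[OF assms(1-3), of "(x \<bullet> i) *\<^sub>R j - (x \<bullet> j) *\<^sub>R i"] assms(4,5)
  by (simp add: dd_rot inner_diff_right)

lemma rot_sum:
  "(\<And>k. k \<in> I \<Longrightarrow> is_poly (f k)) \<Longrightarrow> rot i j (\<lambda>x. \<Sum>k\<in>I. f k x) x = (\<Sum>k\<in>I. rot i j (f k) x)"
  by (simp add: rot_def pd_sum sum_distrib_left sum_subtractf)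

lemma rot_mult:
  "is_poly f \<Longrightarrow> is_poly g \<Longrightarrow> rot i j (\<lambda>x. f x * g x) x = rot i j f x * g x + f x * rot i j g x"
  by (simp add: rot_def pd_mult algebra_simps)

locale sphere_basis =
  fixes e :: "'a::euclidean_space" and t :: nat and b :: "('a \<Rightarrow> nat) \<Rightarrow> 'a \<Rightarrow> real"
  assumes e: "e \<in> Basis"
    and b_deg: "\<And>\<alpha>. \<alpha> \<in> reduced e t \<Longrightarrow> poly_deg_le (sum \<alpha> Basis) (b \<alpha>)"
    and b_orth: "\<And>\<alpha> \<beta>. \<alpha> \<in> reduced e t \<Longrightarrow> \<beta> \<in> reduced e t \<Longrightarrow>
          ip (b \<alpha>) (b \<beta>) = (if \<alpha> = \<beta> then 1 else 0)"
    and b_expand: "\<And>s f x. s \<le> t \<Longrightarrow> poly_deg_le s f \<Longrightarrow> x \<in> sphere 0 1 \<Longrightarrow>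
          f x = (\<Sum>\<alpha>\<in>reduced e s. ip f (b \<alpha>) * b \<alpha> x)"
begin

abbreviation "M \<equiv> reduced e t"

definition kern :: "'a \<Rightarrow> 'a \<Rightarrow> real" where
  "kern x y = (\<Sum>\<alpha>\<in>M. b \<alpha> x * b \<alpha> y)"

lemma b_poly: "\<alpha> \<in> M \<Longrightarrow> is_poly (b \<alpha>)"
  using b_deg is_polyI by blast

lemma b_deg_t: "\<alpha> \<in> M \<Longrightarrow> poly_deg_le t (b \<alpha>)"
  using b_deg[of \<alpha>] by (rule poly_deg_le_mono) (simp_all add: reduced_def multi_indices_def)

text \<open>The reflected kernel, as a function of one argument, has the same basis coefficients as
  the kernel itself: self-adjointness moves the reflection to \<open>b \<beta>\<close>, and the
  expansion of the reflected \<open>b \<beta>\<close> at \<open>?R y\<close> gives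
  \<open>b \<beta> y\<close>.\<close>

lemma kern_householder:
  assumes x: "x \<in> sphere 0 1" and y: "y \<in> sphere 0 1"
  shows "kern (householder w x) (householder w y) = kern x y"
proof -
  let ?R = "householder w"
  define f where "f z = (\<Sum>\<alpha>\<in>M. b \<alpha> (?R y) * b \<alpha> (?R z))" for z
  have bR: "poly_deg_le t (\<lambda>z. b \<alpha> (?R z))" if "\<alpha> \<in> M" for \<alpha>
    using poly_deg_le_linear_compose[OF b_deg_t[OF that] linear_householder] .
  have fdeg: "poly_deg_le t f"
    unfolding f_def [abs_def] by (intro poly_deg_le_sum poly_deg_le_cmult bR)
  have "ip f (b \<beta>) = b \<beta> y" if \<beta>: "\<beta> \<in> M" for \<beta>
  proof -
    have "ip f (b \<beta>) = (\<Sum>\<alpha>\<in>M. ip (\<lambda>z. b \<alpha> (?R y) * b \<alpha> (?R z)) (b \<beta>))"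
      unfolding f_def [abs_def]
      by (rule ip_sum_left[OF b_poly[OF \<beta>]]) (rule is_polyI[OF poly_deg_le_cmult[OF bR]])
    also have "\<dots> = (\<Sum>\<alpha>\<in>M. ip (\<lambda>z. b \<beta> (?R z)) (b \<alpha>) * b \<alpha> (?R y))"
    proof (rule sum.cong[OF refl])
      fix \<alpha> assume \<alpha>: "\<alpha> \<in> M"
      have "ip (\<lambda>z. b \<alpha> (?R y) * b \<alpha> (?R z)) (b \<beta>) = b \<alpha> (?R y) * ip (\<lambda>z. b \<alpha> (?R z)) (b \<beta>)"
        by (rule ip_cmult_left)
      also have "ip (\<lambda>z. b \<alpha> (?R z)) (b \<beta>) = ip (b \<alpha>) (\<lambda>z. b \<beta> (?R z))"
        using \<alpha> \<beta> by (intro ip_householder b_poly)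
      finally show "ip (\<lambda>z. b \<alpha> (?R y) * b \<alpha> (?R z)) (b \<beta>) = ip (\<lambda>z. b \<beta> (?R z)) (b \<alpha>) * b \<alpha> (?R y)"
        by (simp add: ip_commute)
    qed
    also have "\<dots> = b \<beta> (?R (?R y))"
      using b_expand[OF order.refl bR[OF \<beta>], of "?R y"] y by (simp add: norm_householder)
    finally show ?thesis by (simp add: householder_involution)
  qed
  then have "f x = kern x y"
    using b_expand[OF order.refl fdeg x] by (simp add: kern_def mult.commute)
  then show ?thesis by (simp add: f_def kern_def mult.commute)
qed

lemma integral_const_on_sphere:
  fixes f :: "'a \<Rightarrow> real"
  assumes "is_poly f" "\<And>x. x \<in> sphere 0 1 \<Longrightarrow> f x = k"
  shows "ip f (\<lambda>x. 1) = k"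
proof -
  have "ip f (\<lambda>x. 1) = ip (\<lambda>x::'a. k) (\<lambda>x. 1)"
    by (intro ip_cong assms is_poly_const) auto
  also have "\<dots> = k" by (simp add: ip_def measure_sphere_measure_UNIV)
  finally show ?thesis .
qed

lemma ip_one_mult: "ip (\<lambda>x. f x * g x) (\<lambda>x. 1) = ip f g"
  by (simp add: ip_def)

text \<open>Reflections are transitive on the sphere, so the diagonal is constant; its mean counts
  the unit vectors \<open>b \<alpha>\<close>.\<close>

lemma kern_diag:
  assumes x: "x \<in> sphere 0 1" shows "kern x x = real (card M)"
proof -
  have "kern y y = kern x x" if "y \<in> sphere 0 1" for y
    using kern_householder[OF x x, of "x - y"] that x by (simp add: householder_maps)
  then have "ip (\<lambda>y. kern y y) (\<lambda>x. 1) = kern x x"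
    unfolding kern_def by (intro integral_const_on_sphere is_poly_intros b_poly)
  moreover have "ip (\<lambda>y. kern y y) (\<lambda>x. 1) = (\<Sum>\<alpha>\<in>M. ip (\<lambda>y. b \<alpha> y * b \<alpha> y) (\<lambda>x. 1))"
    unfolding kern_def by (intro ip_sum_left is_poly_intros b_poly)
  moreover have "\<dots> = real (card M)"
    by (simp add: ip_one_mult b_orth)
  ultimately show ?thesis by simp
qed

subsection \<open>Tangential derivatives of the basis\<close>

definition tangent_energy :: "'a \<Rightarrow> 'a \<Rightarrow> real" where
  "tangent_energy x v = (\<Sum>\<alpha>\<in>M. (dd (b \<alpha>) x v)\<^sup>2)"

text \<open>Expresses the energy through \<open>kern\<close> alone: the diagonal being constant, the
  squared increment of the embedding is \<open>2 N - 2 kern\<close>. Thus the energy inherits the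
  invariance of the kernel.\<close>

lemma tangent_energy_limit:
  assumes x: "norm x = 1" and v: "norm v = 1" and xv: "x \<bullet> v = 0"
  shows "((\<lambda>s. (2 * real (card M) - 2 * kern (great_circle x v s) x) / s\<^sup>2) \<longlongrightarrow> tangent_energy x v) (at 0)"
proof -
  let ?c = "great_circle x v"
  have "((\<lambda>s. (b \<alpha> (?c s) - b \<alpha> x) / s) \<longlongrightarrow> dd (b \<alpha>) x v) (at 0)" if "\<alpha> \<in> M" for \<alpha>
    using dd_great_circle[OF b_poly[OF that], of x v]
    by (simp add: has_field_derivative_iff great_circle_def)
  then have "((\<lambda>s. \<Sum>\<alpha>\<in>M. ((b \<alpha> (?c s) - b \<alpha> x) / s)\<^sup>2) \<longlongrightarrow> tangent_energy x v) (at 0)"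
    unfolding tangent_energy_def by (intro tendsto_sum tendsto_power)
  moreover have "(\<Sum>\<alpha>\<in>M. ((b \<alpha> (?c s) - b \<alpha> x) / s)\<^sup>2) = (2 * real (card M) - 2 * kern (?c s) x) / s\<^sup>2" for s
  proof -
    have "(\<Sum>\<alpha>\<in>M. (b \<alpha> (?c s) - b \<alpha> x)\<^sup>2) = kern (?c s) (?c s) + kern x x - 2 * kern (?c s) x"
      unfolding kern_def sum_distrib_left sum.distrib[symmetric] sum_subtractf[symmetric]
      by (intro sum.cong refl) (simp add: power2_eq_square algebra_simps)
    also have "\<dots> = 2 * real (card M) - 2 * kern (?c s) x"
      using great_circle_in_sphere[OF assms] x by (simp add: kern_diag)
    finally show ?thesis by (simp add: power_divide flip: sum_divide_distrib)
  qed
  ultimately show ?thesis by simp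
qed

lemma tangent_energy_householder:
  assumes "norm x = 1" "norm v = 1" "x \<bullet> v = 0"
  shows "tangent_energy (householder w x) (householder w v) = tangent_energy x v"
proof -
  let ?R = "householder w"
  have "great_circle (?R x) (?R v) s = ?R (great_circle x v s)" for s
    by (simp add: great_circle_def linear_add[OF linear_householder] linear_cmul[OF linear_householder])
  then have "kern (great_circle (?R x) (?R v) s) (?R x) = kern (great_circle x v s) x" for s
    using kern_householder[OF great_circle_in_sphere[OF assms]] assms(1) by simp
  then have "((\<lambda>s. (2 * real (card M) - 2 * kern (great_circle x v s) x) / s\<^sup>2) \<longlongrightarrow> tangent_energy (?R x) (?R v)) (at 0)"
    using tangent_energy_limit[of "?R x" "?R v"] assms by (simp add: norm_householder householder_inner)
  with tangent_energy_limit[OF assms] show ?thesis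
    using LIM_unique by blast
qed

text \<open>One reflection moves \<open>x\<close> to \<open>x'\<close>; a second one, along
  \<open>u - v'\<close>, moves the image \<open>u\<close> of \<open>v\<close> to \<open>v'\<close>
  and fixes \<open>x'\<close>, which is orthogonal to both.\<close>

lemma tangent_energy_unit:
  assumes "norm x = 1" "norm v = 1" "x \<bullet> v = 0" "norm x' = 1" "norm v' = 1" "x' \<bullet> v' = 0"
  shows "tangent_energy x v = tangent_energy x' v'"
proof -
  let ?R = "householder (x - x')"
  define u where "u = ?R v"
  have Rx: "?R x = x'" using assms by (simp add: householder_maps)
  have u: "norm u = 1" "x' \<bullet> u = 0"
    using assms householder_inner[of "x - x'" x v] by (auto simp: u_def norm_householder Rx)
  have "tangent_energy x v = tangent_energy x' u"
    using tangent_energy_householder[OF assms(1-3), of "x - x'"] by (simp add: Rx u_def)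
  also have "\<dots> = tangent_energy (householder (u - v') x') (householder (u - v') u)"
    using assms u by (simp add: tangent_energy_householder)
  also have "\<dots> = tangent_energy x' v'"
    using assms u by (simp add: householder_maps householder_fixes inner_diff_right)
  finally show ?thesis .
qed

lemma tangent_energy_isotropic:
  obtains \<kappa> where "\<And>x v. x \<in> sphere 0 1 \<Longrightarrow> x \<bullet> v = 0 \<Longrightarrow> tangent_energy x v = \<kappa> * (norm v)\<^sup>2"
proof -
  have scale: "tangent_energy x v = tangent_energy x (v /\<^sub>R norm v) * (norm v)\<^sup>2" if "v \<noteq> 0" for x v
    unfolding tangent_energy_def sum_distrib_right using that
    by (intro sum.cong refl) (simp add: dd_scaleR power_mult_distrib power_inverse field_simps)
  have zero: "tangent_energy x 0 = 0" for x by (simp add: tangent_energy_def dd_def)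
  show ?thesis
  proof (cases "\<exists>x0 v0::'a. norm x0 = 1 \<and> norm v0 = 1 \<and> x0 \<bullet> v0 = 0")
    case True
    then obtain x0 v0 :: 'a where 0: "norm x0 = 1" "norm v0 = 1" "x0 \<bullet> v0 = 0" by blast
    show ?thesis
    proof (rule that[of "tangent_energy x0 v0"])
      fix x v :: 'a assume x: "x \<in> sphere 0 1" "x \<bullet> v = 0"
      show "tangent_energy x v = tangent_energy x0 v0 * (norm v)\<^sup>2"
      proof (cases "v = 0")
        case False
        then show ?thesis
          using scale[OF False, of x] tangent_energy_unit[OF _ _ _ 0, of x "v /\<^sub>R norm v"] x by simp
      qed (simp add: zero)
    qed
  next
    \<comment> \<open>This is dimension 1: every tangent vector is 0 and any constant
      serves.\<close>
    case False
    have "v = 0" if "x \<in> sphere 0 1" "x \<bullet> v = 0" for x v :: 'a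
    proof (rule ccontr)
      assume "v \<noteq> 0"
      then have "norm x = 1 \<and> norm (v /\<^sub>R norm v) = 1 \<and> x \<bullet> (v /\<^sub>R norm v) = 0" using that by simp
      then show False using False by blast
    qed
    then show ?thesis using that[of 0] zero by (metis mult_zero_left)
  qed
qed

text \<open>On the sphere \<open>g\<close> lies in the span of the \<open>b \<beta>\<close> with
  \<open>\<beta> \<in> reduced e r\<close>, where \<open>r\<close> is one less than the degree of
  \<open>\<alpha>\<close>, and \<open>\<alpha>\<close> is not among these.\<close>

lemma ip_b_lower_degree:
  assumes \<alpha>: "\<alpha> \<in> M" and g: "poly_deg_less (sum \<alpha> Basis) g"
  shows "ip (b \<alpha>) g = 0"
proof (cases "sum \<alpha> Basis")
  case 0
  then have "g = (\<lambda>x. 0)" using g by (simp add: poly_deg_less_def)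
  then show ?thesis by (simp add: ip_def)
next
  case (Suc r)
  have g': "poly_deg_le r g" using g Suc by (simp add: poly_deg_less_def)
  have "Suc r \<le> t" using \<alpha> by (simp add: reduced_def multi_indices_def Suc)
  then have r: "r \<le> t" by simp
  have sub: "reduced e r \<subseteq> M" using multi_indices_mono[OF r] by (auto simp: reduced_def)
  have "ip (b \<alpha>) g = ip (b \<alpha>) (\<lambda>x. \<Sum>\<beta>\<in>reduced e r. ip g (b \<beta>) * b \<beta> x)"
    using b_expand[OF r g'] sub \<alpha> by (intro ip_cong is_poly_intros b_poly is_polyI[OF g']) auto
  also have "\<dots> = (\<Sum>\<beta>\<in>reduced e r. ip (b \<alpha>) (\<lambda>x. ip g (b \<beta>) * b \<beta> x))"
    using sub \<alpha> by (intro ip_sum_right is_poly_intros b_poly) auto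
  also have "\<dots> = 0"
  proof (rule sum.neutral, rule ballI)
    fix \<beta> assume \<beta>: "\<beta> \<in> reduced e r"
    then have "\<beta> \<noteq> \<alpha>" using Suc by (auto simp: reduced_def multi_indices_def)
    then show "ip (b \<alpha>) (\<lambda>x. ip g (b \<beta>) * b \<beta> x) = 0"
      using \<alpha> \<beta> sub by (auto simp: ip_cmult_right b_orth)
  qed
  finally show ?thesis .
qed

text \<open>Differentiating \<open>\<Sum> b\<^sub>\<alpha>\<^sup>2 = const\<close> twice along rotations turns the tangential energy into
  \<open>- \<Sum> b\<^sub>\<alpha> \<Delta> b\<^sub>\<alpha>\<close>, whose mean is the trace of the Laplacian.\<close>

lemma sum_rot_squares:
  assumes x: "x \<in> sphere 0 1" and ij: "i \<in> Basis" "j \<in> Basis"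
  shows "(\<Sum>\<alpha>\<in>M. (rot i j (b \<alpha>) x)\<^sup>2) = - (\<Sum>\<alpha>\<in>M. b \<alpha> x * rot i j (rot i j (b \<alpha>)) x)"
proof -
  have pr: "is_poly (rot i j (b \<alpha>))" if "\<alpha> \<in> M" for \<alpha>
    using that ij by (intro is_poly_rot b_poly)
  have z: "(\<Sum>\<alpha>\<in>M. b \<alpha> y * rot i j (b \<alpha>) y) = 0" if y: "y \<in> sphere 0 1" for y
  proof -
    have "rot i j (\<lambda>x. \<Sum>\<alpha>\<in>M. b \<alpha> x * b \<alpha> x) y = 0"
      using y ij kern_diag unfolding kern_def
      by (intro rot_const_on_sphere[where k="real (card M)"] is_poly_intros b_poly) auto
    then have "(\<Sum>\<alpha>\<in>M. 2 * (b \<alpha> y * rot i j (b \<alpha>) y)) = 0"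
      by (simp add: rot_sum rot_mult is_poly_mult b_poly mult.commute)
    then show ?thesis by (simp flip: sum_distrib_left)
  qed
  have "rot i j (\<lambda>x. \<Sum>\<alpha>\<in>M. b \<alpha> x * rot i j (b \<alpha>) x) x = 0"
    using x ij z by (intro rot_const_on_sphere[where k=0] is_poly_intros b_poly pr) auto
  then have "(\<Sum>\<alpha>\<in>M. (rot i j (b \<alpha>) x)\<^sup>2 + b \<alpha> x * rot i j (rot i j (b \<alpha>)) x) = 0"
    by (simp add: rot_sum rot_mult is_poly_mult b_poly pr power2_eq_square)
  then show ?thesis by (simp add: sum.distrib)
qed

text \<open>Sum \<open>sum_rot_squares\<close> over all rotation fields and integrate. On the left
  the squared lengths of the fields add up to \<open>2 d\<close> at each point of the sphere; on the
  right the lower-degree remainders are orthogonal to \<open>b \<alpha>\<close>, so only the scalars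
  survive.\<close>

lemma tangent_energy_constant:
  assumes \<kappa>: "\<And>x v. x \<in> sphere 0 1 \<Longrightarrow> x \<bullet> v = 0 \<Longrightarrow> tangent_energy x v = \<kappa> * (norm v)\<^sup>2"
    and d: "DIM('a) = Suc d"
  shows "real d * \<kappa> = (\<Sum>\<alpha>\<in>M. real (sum \<alpha> Basis) * (real (sum \<alpha> Basis) + real d - 1))"
proof -
  \<comment> \<open>Twice the spherical eigenvalue for the degree of \<open>\<alpha>\<close>,
    because ordered pairs count every plane twice.\<close>
  define ev where "ev \<alpha> = 2 * real (sum \<alpha> Basis) * (real (sum \<alpha> Basis) + real d - 1)" for \<alpha> :: "'a \<Rightarrow> nat"
  have "\<forall>\<alpha>\<in>M. \<exists>g. poly_deg_less (sum \<alpha> Basis) g \<and>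
      (\<forall>x\<in>sphere 0 1. (\<Sum>i\<in>Basis. \<Sum>j\<in>Basis. rot i j (rot i j (b \<alpha>)) x) = - ev \<alpha> * b \<alpha> x + g x)"
  proof
    fix \<alpha> assume "\<alpha> \<in> M"
    from sum_rot_rot_sphere[OF b_deg[OF this]]
    show "\<exists>g. poly_deg_less (sum \<alpha> Basis) g \<and>
      (\<forall>x\<in>sphere 0 1. (\<Sum>i\<in>Basis. \<Sum>j\<in>Basis. rot i j (rot i j (b \<alpha>)) x) = - ev \<alpha> * b \<alpha> x + g x)"
      by (simp add: ev_def d)
  qed
  from bchoice[OF this] obtain g where
    g: "\<And>\<alpha>. \<alpha> \<in> M \<Longrightarrow> poly_deg_less (sum \<alpha> Basis) (g \<alpha>)"
    and rr: "\<And>\<alpha> x. \<alpha> \<in> M \<Longrightarrow> x \<in> sphere 0 1 \<Longrightarrow>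
        (\<Sum>i\<in>Basis. \<Sum>j\<in>Basis. rot i j (rot i j (b \<alpha>)) x) = - ev \<alpha> * b \<alpha> x + g \<alpha> x" by blast
  have pg: "is_poly (g \<alpha>)" if "\<alpha> \<in> M" for \<alpha>
    using g[OF that] poly_deg_less_imp_le is_polyI by blast
  define F where "F x = (\<Sum>\<alpha>\<in>M. ev \<alpha> * (b \<alpha> x * b \<alpha> x) - b \<alpha> x * g \<alpha> x)" for x
  have pF: "is_poly F" unfolding F_def [abs_def] by (intro is_poly_intros b_poly pg)
  have "F x = 2 * real d * \<kappa>" if x: "x \<in> sphere 0 1" for x
  proof -
    let ?v = "\<lambda>i j. (x \<bullet> i) *\<^sub>R j - (x \<bullet> j) *\<^sub>R i"
    have xx: "(\<Sum>i\<in>Basis. (x \<bullet> i)\<^sup>2) = 1"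
      using x euclidean_inner[of x x] by (simp add: power2_eq_square dot_square_norm)
    have nv: "(norm (?v i j))\<^sup>2 = (x \<bullet> i)\<^sup>2 + (x \<bullet> j)\<^sup>2 - 2 * ((i \<bullet> j) * ((x \<bullet> i) * (x \<bullet> j)))"
      if "i \<in> Basis" "j \<in> Basis" for i j
      using that unfolding power2_norm_eq_inner
      by (auto simp: inner_diff_left inner_diff_right inner_Basis power2_eq_square algebra_simps)
    have "(\<Sum>i\<in>Basis. \<Sum>j\<in>Basis. (norm (?v i j))\<^sup>2) =
        (\<Sum>i\<in>Basis. \<Sum>j\<in>Basis. (x \<bullet> i)\<^sup>2 + (x \<bullet> j)\<^sup>2 - 2 * ((i \<bullet> j) * ((x \<bullet> i) * (x \<bullet> j))))"
      by (intro sum.cong refl nv)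
    also have "\<dots> = 2 * real DIM('a) * (\<Sum>i\<in>Basis. (x \<bullet> i)\<^sup>2) - 2 * (\<Sum>i\<in>Basis. (x \<bullet> i)\<^sup>2)"
      by (simp add: sum.distrib sum_subtractf inner_Basis_sum power2_eq_square flip: sum_distrib_left)
    finally have nsum: "(\<Sum>i\<in>Basis. \<Sum>j\<in>Basis. (norm (?v i j))\<^sup>2) = 2 * real d"
      by (simp add: xx d)
    have "2 * real d * \<kappa> = (\<Sum>i\<in>Basis. \<Sum>j\<in>Basis. \<kappa> * (norm (?v i j))\<^sup>2)"
      unfolding sum_distrib_left[symmetric] nsum by simp
    also have "\<dots> = (\<Sum>i\<in>Basis. \<Sum>j\<in>Basis. \<Sum>\<alpha>\<in>M. (rot i j (b \<alpha>) x)\<^sup>2)"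
    proof (intro sum.cong refl)
      fix i j :: 'a assume ij: "i \<in> Basis" "j \<in> Basis"
      have "tangent_energy x (?v i j) = \<kappa> * (norm (?v i j))\<^sup>2"
        by (rule \<kappa>[OF x]) (simp add: inner_diff_right)
      then show "\<kappa> * (norm (?v i j))\<^sup>2 = (\<Sum>\<alpha>\<in>M. (rot i j (b \<alpha>) x)\<^sup>2)"
        using ij by (simp add: tangent_energy_def dd_rot)
    qed
    also have "\<dots> = (\<Sum>i\<in>Basis. \<Sum>j\<in>Basis. - (\<Sum>\<alpha>\<in>M. b \<alpha> x * rot i j (rot i j (b \<alpha>)) x))"
      by (intro sum.cong refl sum_rot_squares x)
    also have "\<dots> = - (\<Sum>i\<in>Basis. \<Sum>j\<in>Basis. \<Sum>\<alpha>\<in>M. b \<alpha> x * rot i j (rot i j (b \<alpha>)) x)"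
      by (simp add: sum_negf)
    also have "(\<Sum>i\<in>Basis. \<Sum>j\<in>Basis. \<Sum>\<alpha>\<in>M. b \<alpha> x * rot i j (rot i j (b \<alpha>)) x) =
        (\<Sum>\<alpha>\<in>M. \<Sum>i\<in>Basis. \<Sum>j\<in>Basis. b \<alpha> x * rot i j (rot i j (b \<alpha>)) x)"
      by (subst (2) sum.swap, subst sum.swap) (rule refl)
    also have "\<dots> = (\<Sum>\<alpha>\<in>M. b \<alpha> x * (- ev \<alpha> * b \<alpha> x + g \<alpha> x))"
      using rr[OF _ x] by (simp flip: sum_distrib_left)
    also have "- \<dots> = F x"
      unfolding F_def sum_negf[symmetric] by (intro sum.cong refl) (simp add: algebra_simps)
    finally show ?thesis by simp
  qed
  then have "2 * real d * \<kappa> = ip F (\<lambda>x. 1)"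
    using integral_const_on_sphere[OF pF] by simp
  also have "\<dots> = (\<Sum>\<alpha>\<in>M. ip (\<lambda>x. ev \<alpha> * (b \<alpha> x * b \<alpha> x) - b \<alpha> x * g \<alpha> x) (\<lambda>x. 1))"
    unfolding F_def [abs_def] by (intro ip_sum_left is_poly_intros b_poly pg)
  also have "\<dots> = (\<Sum>\<alpha>\<in>M. ev \<alpha>)"
  proof (intro sum.cong refl)
    fix \<alpha> assume \<alpha>: "\<alpha> \<in> M"
    have "ip (\<lambda>x. 1) (\<lambda>x. ev \<alpha> * (b \<alpha> x * b \<alpha> x) - b \<alpha> x * g \<alpha> x) =
       ip (\<lambda>x. 1) (\<lambda>x. ev \<alpha> * (b \<alpha> x * b \<alpha> x)) - ip (\<lambda>x. 1) (\<lambda>x. b \<alpha> x * g \<alpha> x)"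
      using \<alpha> by (intro ip_diff_right is_poly_intros b_poly pg)
    also have "\<dots> = ev \<alpha> * ip (b \<alpha>) (b \<alpha>) - ip (b \<alpha>) (g \<alpha>)"
      unfolding ip_cmult_right by (simp only: ip_commute[of "\<lambda>x. 1"] ip_one_mult)
    also have "\<dots> = ev \<alpha>" using \<alpha> by (simp add: b_orth ip_b_lower_degree[OF \<alpha> g])
    finally show "ip (\<lambda>x. ev \<alpha> * (b \<alpha> x * b \<alpha> x) - b \<alpha> x * g \<alpha> x) (\<lambda>x. 1) = ev \<alpha>"
      by (simp add: ip_commute)
  qed
  also have "\<dots> = 2 * (\<Sum>\<alpha>\<in>M. real (sum \<alpha> Basis) * (real (sum \<alpha> Basis) + real d - 1))"
    unfolding ev_def by (simp only: sum_distrib_left[of 2] mult.assoc)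
  finally show ?thesis by simp
qed

lemma tangent_energy_eq:
  assumes d: "DIM('a) = Suc d" "d > 0" and "x \<in> sphere 0 1" "x \<bullet> v = 0"
  shows "tangent_energy x v = real (card M) * real t * (real t + real d) / (real d + 2) * (norm v)\<^sup>2"
proof -
  obtain \<kappa> where \<kappa>: "\<And>x v. x \<in> sphere 0 1 \<Longrightarrow> x \<bullet> v = 0 \<Longrightarrow> tangent_energy x v = \<kappa> * (norm v)\<^sup>2"
    using tangent_energy_isotropic by blast
  have "(real d + 2) * (real d * \<kappa>) = real (card M) * real t * (real t + real d) * real d"
    using tangent_energy_constant[OF \<kappa> d(1)] sum_reduced_eigenvalues[OF e d(1), of t] by simp
  then have "(real d + 2) * \<kappa> = real (card M) * real t * (real t + real d)"
    using d(2) by simp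
  then have "\<kappa> = real (card M) * real t * (real t + real d) / (real d + 2)"
    by (simp add: field_simps)
  then show ?thesis using \<kappa>[OF assms(3,4)] by simp
qed

end

section \<open>Projections killing finitely many vectors\<close>

text \<open>Matrices of orthogonal projections of the coordinate space over \<open>I\<close>;
  \<open>I\<close> will be the set of reduced exponents.\<close>

definition sym_idem :: "'i set \<Rightarrow> ('i \<Rightarrow> 'i \<Rightarrow> real) \<Rightarrow> bool" where
  "sym_idem I P \<longleftrightarrow> (\<forall>i\<in>I. \<forall>j\<in>I. P i j = P j i) \<and> (\<forall>i\<in>I. \<forall>j\<in>I. (\<Sum>k\<in>I. P i k * P k j) = P i j)"

lemma sym_idem_sym: "sym_idem I P \<Longrightarrow> i \<in> I \<Longrightarrow> j \<in> I \<Longrightarrow> P i j = P j i"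
  unfolding sym_idem_def by blast

lemma sym_idem_idem: "sym_idem I P \<Longrightarrow> i \<in> I \<Longrightarrow> j \<in> I \<Longrightarrow> (\<Sum>k\<in>I. P i k * P k j) = P i j"
  unfolding sym_idem_def by blast

lemma sym_idem_apply:
  assumes "sym_idem I P" "i \<in> I"
  shows "(\<Sum>k\<in>I. P i k * (\<Sum>j\<in>I. P k j * x j)) = (\<Sum>j\<in>I. P i j * x j)"
proof -
  have "(\<Sum>k\<in>I. P i k * (\<Sum>j\<in>I. P k j * x j)) = (\<Sum>k\<in>I. \<Sum>j\<in>I. P i k * P k j * x j)"
    by (simp add: sum_distrib_left mult.assoc)
  also have "\<dots> = (\<Sum>j\<in>I. (\<Sum>k\<in>I. P i k * P k j) * x j)"
    by (subst sum.swap) (simp add: sum_distrib_right)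
  finally show ?thesis using assms by (simp add: sym_idem_idem)
qed

lemma sym_idem_adjoint:
  assumes "sym_idem I P"
  shows "(\<Sum>i\<in>I. (\<Sum>j\<in>I. P i j * x j) * y i) = (\<Sum>i\<in>I. x i * (\<Sum>j\<in>I. P i j * y j))"
proof -
  have "(\<Sum>i\<in>I. (\<Sum>j\<in>I. P i j * x j) * y i) = (\<Sum>i\<in>I. \<Sum>j\<in>I. P i j * x j * y i)"
    by (simp add: sum_distrib_right)
  also have "\<dots> = (\<Sum>j\<in>I. \<Sum>i\<in>I. P i j * x j * y i)" by (rule sum.swap)
  also have "\<dots> = (\<Sum>j\<in>I. x j * (\<Sum>i\<in>I. P j i * y i))"
    unfolding sum_distrib_left using assms
    by (intro sum.cong refl) (auto simp: sym_idem_def)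
  finally show ?thesis .
qed

text \<open>For \<open>y = P x\<close>, symmetry and idempotence make the inner products of
  \<open>y\<close> with \<open>y\<close> and with \<open>x\<close> equal, so
  \<open>|x - y|^2 = |x|^2 - |y|^2\<close>.\<close>

lemma sym_idem_contraction:
  assumes P: "sym_idem I P"
  shows "(\<Sum>i\<in>I. (\<Sum>j\<in>I. P i j * x j)\<^sup>2) \<le> (\<Sum>i\<in>I. (x i)\<^sup>2)"
proof -
  define y where "y i = (\<Sum>j\<in>I. P i j * x j)" for i
  have "(\<Sum>i\<in>I. y i * y i) = (\<Sum>i\<in>I. x i * (\<Sum>j\<in>I. P i j * y j))"
    unfolding y_def by (rule sym_idem_adjoint[OF P])
  also have "\<dots> = (\<Sum>i\<in>I. x i * y i)"
    unfolding y_def using sym_idem_apply[OF P] by simp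
  finally have yy: "(\<Sum>i\<in>I. (y i)\<^sup>2) = (\<Sum>i\<in>I. x i * y i)" by (simp add: power2_eq_square)
  have "0 \<le> (\<Sum>i\<in>I. (x i - y i)\<^sup>2)" by (rule sum_nonneg) simp
  also have "\<dots> = (\<Sum>i\<in>I. (x i)\<^sup>2) + (\<Sum>i\<in>I. (y i)\<^sup>2) - 2 * (\<Sum>i\<in>I. x i * y i)"
    by (simp add: power2_diff sum.distrib sum_subtractf sum_distrib_left mult.assoc)
  finally show ?thesis using yy by (simp add: y_def)
qed

text \<open>Each vector costs at most one dimension: what \<open>P\<close> leaves of
  \<open>y n\<close>, namely \<open>z\<close>, is split off by a rank-one correction that lowers the
  trace by exactly 1. If \<open>z = 0\<close> then \<open>P\<close> is kept, whence the
  inequality.\<close>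

lemma sym_idem_killing:
  fixes y :: "nat \<Rightarrow> 'i \<Rightarrow> real"
  assumes "finite I"
  shows "\<exists>P. sym_idem I P \<and> (\<forall>m<n. \<forall>i\<in>I. (\<Sum>j\<in>I. P i j * y m j) = 0) \<and>
     real (card I) - real n \<le> (\<Sum>i\<in>I. P i i)"
proof (induction n)
  case 0
  have "sym_idem I (\<lambda>i j. if i = j then 1 else 0)"
    using assms by (auto simp: sym_idem_def if_distrib[of "\<lambda>c. c * _"] cong: if_cong)
  then show ?case by (intro exI[of _ "\<lambda>i j. if i = j then 1 else 0"]) simp
next
  case (Suc n)
  then obtain P where P: "sym_idem I P" and kill: "\<And>m i. m < n \<Longrightarrow> i \<in> I \<Longrightarrow> (\<Sum>j\<in>I. P i j * y m j) = 0"
    and tr: "real (card I) - real n \<le> (\<Sum>i\<in>I. P i i)" by blast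
  define z where "z i = (\<Sum>j\<in>I. P i j * y n j)" for i
  define q where "q = (\<Sum>i\<in>I. z i * z i)"
  show ?case
  proof (cases "q = 0")
    case True
    then have "z i = 0" if "i \<in> I" for i
      using that assms by (simp add: q_def sum_nonneg_eq_0_iff)
    then have "(\<Sum>j\<in>I. P i j * y m j) = 0" if "m < Suc n" "i \<in> I" for m i
      using that kill by (auto simp: less_Suc_eq z_def)
    then show ?thesis using P tr by (intro exI[of _ P]) auto
  next
    case False
    define P' where "P' i j = P i j - z i * z j / q" for i j
    have Pz: "(\<Sum>k\<in>I. P i k * z k) = z i" if "i \<in> I" for i
      unfolding z_def by (rule sym_idem_apply[OF P that])
    have zP: "(\<Sum>k\<in>I. z k * P k i) = z i" if "i \<in> I" for i
    proof -
      have "(\<Sum>k\<in>I. z k * P k i) = (\<Sum>k\<in>I. P i k * z k)"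
        using P that by (intro sum.cong refl) (auto simp: sym_idem_def)
      then show ?thesis using Pz[OF that] by simp
    qed
    have zy: "(\<Sum>j\<in>I. z j * y m j) = 0" if "m < n" for m
      unfolding z_def sym_idem_adjoint[OF P] using kill[OF that] by simp
    have zn: "(\<Sum>j\<in>I. z j * y n j) = q"
    proof -
      have "q = (\<Sum>i\<in>I. y n i * (\<Sum>j\<in>I. P i j * z j))"
        unfolding q_def by (subst (1) z_def) (rule sym_idem_adjoint[OF P])
      then show ?thesis using Pz by (simp add: mult.commute)
    qed
    have "(\<Sum>k\<in>I. P' i k * P' k j) = P' i j" if "i \<in> I" "j \<in> I" for i j
    proof -
      have "P' i k * P' k j = P i k * P k j - P i k * z k * (z j / q) - z k * P k j * (z i / q)
          + z k * z k * (z i * z j / (q * q))" for k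
        using False by (simp add: P'_def field_simps)
      then have "(\<Sum>k\<in>I. P' i k * P' k j) = (\<Sum>k\<in>I. P i k * P k j) - (\<Sum>k\<in>I. P i k * z k) * (z j / q)
          - (\<Sum>k\<in>I. z k * P k j) * (z i / q) + (\<Sum>k\<in>I. z k * z k) * (z i * z j / (q * q))"
        by (simp only: sum.distrib sum_subtractf sum_distrib_right)
      also have "\<dots> = P' i j"
        using that False by (simp add: Pz zP sym_idem_idem[OF P] P'_def flip: q_def)
      finally show ?thesis .
    qed
    moreover have "P' i j = P' j i" if "i \<in> I" "j \<in> I" for i j
      using that P by (simp add: P'_def sym_idem_def mult.commute)
    ultimately have "sym_idem I P'" by (simp add: sym_idem_def)
    moreover have "(\<Sum>j\<in>I. P' i j * y m j) = 0" if "m < Suc n" "i \<in> I" for m i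
    proof -
      have "(\<Sum>j\<in>I. P' i j * y m j) = (\<Sum>j\<in>I. P i j * y m j) - z i / q * (\<Sum>j\<in>I. z j * y m j)"
        by (simp add: P'_def left_diff_distrib sum_subtractf sum_distrib_left mult.assoc)
      then show ?thesis
        using that kill zy zn False by (auto simp: less_Suc_eq z_def)
    qed
    moreover have "(\<Sum>i\<in>I. P' i i) = (\<Sum>i\<in>I. P i i) - 1"
      using False by (simp add: P'_def sum_subtractf q_def flip: sum_divide_distrib)
    ultimately show ?thesis using tr by (intro exI[of _ P']) auto
  qed
qed

section \<open>The embedding along the curve\<close>

text \<open>Translates the unit-speed condition into the negligible exceptional set that
  \<open>has_integral_spike\<close> expects.\<close>

lemma AE_lborel_negligible:
  assumes "AE u in lborel. Q u"
  shows "\<exists>N. negligible N \<and> (\<forall>u. u \<notin> N \<longrightarrow> Q u)"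
proof -
  from AE_E[OF assms] obtain N where N: "{u \<in> space lborel. \<not> Q u} \<subseteq> N" "emeasure lborel N = 0" "N \<in> sets lborel"
    by blast
  then have "N \<in> null_sets lebesgue" by (intro null_sets_completionI) auto
  then have "negligible N" by (simp add: negligible_iff_null_sets)
  then show ?thesis using N(1) by (intro exI[of _ N]) auto
qed

lemma dd_sum_cmult:
  assumes "\<And>k. k \<in> I \<Longrightarrow> is_poly (f k)"
  shows "dd (\<lambda>x. \<Sum>k\<in>I. c k * f k x) x v = (\<Sum>k\<in>I. c k * dd (f k) x v)"
proof -
  have "pd i (\<lambda>x. \<Sum>k\<in>I. c k * f k x) x = (\<Sum>k\<in>I. c k * pd i (f k) x)" for i
    by (simp add: pd_sum pd_cmult assms is_poly_mult is_poly_const)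
  then have "dd (\<lambda>x. \<Sum>k\<in>I. c k * f k x) x v = (\<Sum>i\<in>Basis. \<Sum>k\<in>I. c k * ((v \<bullet> i) * pd i (f k) x))"
    by (simp add: dd_def sum_distrib_left mult.left_commute)
  also have "\<dots> = (\<Sum>k\<in>I. c k * dd (f k) x v)"
    by (subst sum.swap) (simp add: dd_def sum_distrib_left)
  finally show ?thesis .
qed

lemma sphere_curve_tangent:
  fixes \<gamma> :: "real \<Rightarrow> 'a::euclidean_space"
  assumes "\<And>u. u \<in> {0<..<L} \<Longrightarrow> \<gamma> u \<in> sphere 0 1" "s \<in> {0<..<L}" "(\<gamma> has_vector_derivative D) (at s)"
  shows "\<gamma> s \<bullet> D = 0"
proof -
  have "((\<lambda>r. \<gamma> r \<bullet> \<gamma> r) has_vector_derivative (\<gamma> s \<bullet> D + D \<bullet> \<gamma> s)) (at s)"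
    by (rule bounded_bilinear.has_vector_derivative[OF bounded_bilinear_inner assms(3) assms(3)])
  moreover have "((\<lambda>r. \<gamma> r \<bullet> \<gamma> r) has_vector_derivative 0) (at s)"
  proof (rule has_vector_derivative_transform_within_open)
    show "((\<lambda>r. 1::real) has_vector_derivative 0) (at s)" by simp
    show "open {0<..<L}" by simp
    show "s \<in> {0<..<L}" by fact
    show "1 = \<gamma> r \<bullet> \<gamma> r" if "r \<in> {0<..<L}" for r using assms(1)[OF that] by (simp add: dot_square_norm)
  qed
  ultimately have "\<gamma> s \<bullet> D + D \<bullet> \<gamma> s = 0" by (rule vector_derivative_unique_at)
  then show ?thesis by (simp add: inner_commute)
qed

context sphere_basis
begin

text \<open>Pairing the embedding with its increment \<open>z\<close> gives a scalar polynomial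
  \<open>f\<close> whose own increment is \<open>|z|^2\<close>. Cauchy--Schwarz bounds its
  derivative along the curve by \<open>|z| sqrt \<kappa>\<close>, and integrating gives
  \<open>|z| \<le> sqrt \<kappa> (v - u)\<close>.\<close>

lemma curve_increment:
  assumes curve: "arclength_sphere_curve \<gamma> L"
    and \<kappa>: "\<And>x v. x \<in> sphere 0 1 \<Longrightarrow> x \<bullet> v = 0 \<Longrightarrow> tangent_energy x v = \<kappa> * (norm v)\<^sup>2"
    and "\<kappa> \<ge> 0" and uv: "0 \<le> u" "u \<le> v" "v \<le> L"
  shows "(\<Sum>\<alpha>\<in>M. (b \<alpha> (\<gamma> v) - b \<alpha> (\<gamma> u))\<^sup>2) \<le> \<kappa> * (v - u)\<^sup>2"
proof -
  define z where "z \<alpha> = b \<alpha> (\<gamma> v) - b \<alpha> (\<gamma> u)" for \<alpha>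
  define q where "q = (\<Sum>\<alpha>\<in>M. (z \<alpha>)\<^sup>2)"
  define f where "f x = (\<Sum>\<alpha>\<in>M. z \<alpha> * b \<alpha> x)" for x
  have pf: "is_poly f" unfolding f_def [abs_def] by (intro is_poly_intros b_poly)
  have q0: "q \<ge> 0" unfolding q_def by (rule sum_nonneg) simp
  have fq: "f (\<gamma> v) - f (\<gamma> u) = q"
    by (simp add: f_def q_def z_def power2_eq_square right_diff_distrib flip: sum_subtractf)
  have cont: "continuous_on {0..L} \<gamma>" and on: "\<And>s. s \<in> {0..L} \<Longrightarrow> \<gamma> s \<in> sphere 0 1"
    using curve by (auto simp: arclength_sphere_curve_def)
  obtain S where S: "finite S" "\<And>s. s \<in> {0..L} - S \<Longrightarrow> \<gamma> differentiable (at s)"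
    using curve unfolding arclength_sphere_curve_def piecewise_C1_differentiable_on_def C1_differentiable_on_eq by blast
  have der: "(\<gamma> has_vector_derivative vector_derivative \<gamma> (at s)) (at s)" if "s \<in> {0..L} - S" for s
    using S(2)[OF that] vector_derivative_works by blast
  have "AE s in lborel. s \<in> {0..L} \<longrightarrow> norm (vector_derivative \<gamma> (at s)) = 1"
    using curve by (simp add: arclength_sphere_curve_def)
  from AE_lborel_negligible[OF this] obtain N where N: "negligible N"
    "\<And>s. s \<notin> N \<Longrightarrow> s \<in> {0..L} \<longrightarrow> norm (vector_derivative \<gamma> (at s)) = 1"
    by (elim exE conjE) simp
  let ?D = "\<lambda>s. dd f (\<gamma> s) (vector_derivative \<gamma> (at s))"
  have "(?D has_integral (f (\<gamma> v) - f (\<gamma> u))) {u..v}"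
  proof (rule fundamental_theorem_of_calculus_interior_strong[OF S(1) uv(2)])
    fix s assume "s \<in> {u<..<v} - S"
    then have s: "s \<in> {0..L} - S" using uv by auto
    have "((f \<circ> \<gamma>) has_derivative (dd f (\<gamma> s) \<circ> (\<lambda>h. h *\<^sub>R vector_derivative \<gamma> (at s)))) (at s)"
      by (rule diff_chain_at[OF der[OF s, unfolded has_vector_derivative_def] dd_has_derivative[OF pf]])
    then show "((\<lambda>s. f (\<gamma> s)) has_vector_derivative ?D s) (at s)"
      by (simp add: has_vector_derivative_def o_def dd_scaleR)
  next
    show "continuous_on {u..v} (\<lambda>s. f (\<gamma> s))"
      using uv by (intro continuous_on_compose2[OF is_poly_continuous_on[OF pf, of UNIV]] continuous_on_subset[OF cont]) auto
  qed
  then have int: "(?D has_integral q) {u..v}" by (simp only: fq)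
  \<comment> \<open>Off \<open>?E\<close> the curve is differentiable with unit speed and the
    parameter is interior, as the tangency argument requires. On \<open>?E\<close> the derivative is
    replaced by 0, which keeps the integral and makes the bound hold at every point.\<close>
  let ?E = "N \<union> (S \<union> {u, v})"
  have "((\<lambda>s. if s \<in> ?E then 0 else ?D s) has_integral q) {u..v}"
    by (rule has_integral_spike[OF _ _ int, of ?E]) (auto simp: N(1) S(1) negligible_finite)
  moreover have "norm (if s \<in> ?E then 0 else ?D s) \<le> sqrt (q * \<kappa>)" if "s \<in> {u..v}" for s
  proof (cases "s \<in> ?E")
    case True
    then show ?thesis using q0 \<open>\<kappa> \<ge> 0\<close> by simp
  next
    case False
    then have s: "s \<in> {0<..<L}" "s \<in> {0..L} - S" "s \<notin> N" using that uv by auto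
    let ?g = "vector_derivative \<gamma> (at s)"
    have tang: "\<gamma> s \<bullet> ?g = 0"
      by (rule sphere_curve_tangent[OF on s(1) der[OF s(2)]]) auto
    have "(?D s)\<^sup>2 = (\<Sum>\<alpha>\<in>M. z \<alpha> * dd (b \<alpha>) (\<gamma> s) ?g)\<^sup>2"
      unfolding f_def [abs_def] by (simp add: dd_sum_cmult b_poly)
    also have "\<dots> \<le> q * tangent_energy (\<gamma> s) ?g"
      unfolding q_def tangent_energy_def by (rule Cauchy_Schwarz_ineq_sum)
    also have "\<dots> = q * \<kappa>" using \<kappa>[OF on tang] N(2)[OF s(3)] s(2) by simp
    finally have "\<bar>?D s\<bar> \<le> sqrt (q * \<kappa>)" by (rule real_le_rsqrt[of "\<bar>?D s\<bar>", simplified])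
    then show ?thesis using False by simp
  qed
  ultimately have "norm q \<le> sqrt (q * \<kappa>) * (v - u)"
    using has_integral_bound[of "sqrt (q * \<kappa>)" "\<lambda>s. if s \<in> ?E then 0 else ?D s" q u v] q0 \<open>\<kappa> \<ge> 0\<close> uv(2)
    by (simp only: cbox_interval content_real real_sqrt_ge_zero mult_nonneg_nonneg)
  then have "q\<^sup>2 \<le> (sqrt (q * \<kappa>) * (v - u))\<^sup>2" using q0 by (intro power_mono) auto
  also have "\<dots> = q * (\<kappa> * (v - u)\<^sup>2)" using q0 \<open>\<kappa> \<ge> 0\<close> by (simp add: power_mult_distrib)
  finally have "q * q \<le> q * (\<kappa> * (v - u)\<^sup>2)" by (simp add: power2_eq_square)
  then have "q \<le> \<kappa> * (v - u)\<^sup>2"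
    using q0 \<open>\<kappa> \<ge> 0\<close> by (cases "q = 0") auto
  then show ?thesis by (simp add: q_def z_def)
qed

end

section \<open>The length estimate\<close>

text \<open>Gauge integrability alone is not preserved by continuous factors; nonnegativity of
  \<open>h\<close> upgrades it to absolute integrability, which bounded measurable factors
  preserve.\<close>

lemma continuous_mult_integrable:
  fixes g h :: "real \<Rightarrow> real"
  assumes "continuous_on {0..L} g" "h integrable_on {0..L}" "\<And>u. u \<in> {0..L} \<Longrightarrow> 0 \<le> h u"
  shows "(\<lambda>u. g u * h u) integrable_on {0..L}"
proof -
  have "h absolutely_integrable_on {0..L}"
    using assms(2,3) by (rule nonnegative_absolutely_integrable_1)
  moreover have "g \<in> borel_measurable (lebesgue_on {0..L})"
    by (intro continuous_imp_measurable_on_sets_lebesgue assms) auto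
  moreover have "bounded (g ` {0..L})"
    by (intro compact_imp_bounded compact_continuous_image assms) auto
  ultimately have "(\<lambda>u. g u * h u) absolutely_integrable_on {0..L}"
    by (intro absolutely_integrable_bounded_measurable_product_real) auto
  then show ?thesis by (rule set_lebesgue_integral_eq_integral)
qed

lemma nearby_midpoint:
  assumes "0 < L" "0 < n" "0 \<le> u" "u \<le> L"
  obtains m where "m < n" "\<bar>u - (2 * real m + 1) * L / (2 * real n)\<bar> \<le> L / (2 * real n)"
proof -
  define q where "q = u * real n / L"
  have q: "0 \<le> q" "q \<le> real n" using assms by (auto simp: q_def field_simps)
  obtain m where m: "m < n" "real m \<le> q" "q \<le> real m + 1"
  proof (cases "q < real n")
    case True
    show ?thesis
    proof (rule that[of "nat \<lfloor>q\<rfloor>"])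
      show "nat \<lfloor>q\<rfloor> < n" using True q by (simp add: nat_less_iff floor_less_iff)
      show "real (nat \<lfloor>q\<rfloor>) \<le> q" "q \<le> real (nat \<lfloor>q\<rfloor>) + 1" using q by linarith+
    qed
  next
    \<comment> \<open>This is the right end \<open>u = L\<close>, where the floor would be
      \<open>n\<close>; it is assigned to the last arc.\<close>
    case False
    then show ?thesis using that[of "n - 1"] assms q by (auto simp: of_nat_diff)
  qed
  have "u - (2 * real m + 1) * L / (2 * real n) = (2 * (q - real m) - 1) * (L / (2 * real n))"
    using assms by (simp add: q_def field_simps)
  then have "\<bar>u - (2 * real m + 1) * L / (2 * real n)\<bar> = \<bar>2 * (q - real m) - 1\<bar> * (L / (2 * real n))"
    using assms by (simp add: abs_mult)
  also have "\<dots> \<le> 1 * (L / (2 * real n))"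
    using m assms by (intro mult_right_mono) auto
  finally show ?thesis using that m(1) by simp
qed

lemma sphere_L2sq_one: "sphere_L2sq (\<lambda>x. 1) = 1"
  by (simp add: sphere_L2sq_def measure_sphere_measure_UNIV)

context sphere_basis
begin

lemma sphere_L2sq_combination:
  "sphere_L2sq (\<lambda>x. \<Sum>\<beta>\<in>M. c \<beta> * b \<beta> x) = (\<Sum>\<beta>\<in>M. (c \<beta>)\<^sup>2)"
proof -
  let ?f = "\<lambda>x. \<Sum>\<beta>\<in>M. c \<beta> * b \<beta> x"
  have pf: "is_poly ?f" by (intro is_poly_intros b_poly)
  have "ip (b \<alpha>) ?f = c \<alpha>" if "\<alpha> \<in> M" for \<alpha>
  proof -
    have "ip (b \<alpha>) ?f = (\<Sum>\<beta>\<in>M. ip (b \<alpha>) (\<lambda>x. c \<beta> * b \<beta> x))"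
      using that by (intro ip_sum_right is_poly_intros b_poly)
    also have "\<dots> = c \<alpha>"
      using that by (simp add: ip_cmult_right b_orth finite_reduced if_distrib[of "\<lambda>c. _ * c"] cong: if_cong)
    finally show ?thesis .
  qed
  moreover have "ip ?f ?f = (\<Sum>\<alpha>\<in>M. ip (\<lambda>x. c \<alpha> * b \<alpha> x) ?f)"
    by (intro ip_sum_left pf is_poly_intros b_poly)
  ultimately show ?thesis
    by (simp add: sphere_L2sq_ip ip_cmult_left power2_eq_square)
qed

text \<open>The trace of the quadratic form over the range of a projection that kills the point
  evaluations at the \<open>n\<close> midpoints is at least \<open>a (N - n)\<close>, and at most \<open>A\<close> times the squared
  distance of the embedded curve to these points.\<close>

lemma MZ_curve_trace:
  fixes \<gamma> :: "real \<Rightarrow> 'a"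
  assumes MZ: "weighted_MZ_curve t a A \<gamma> L w" and "0 < a" and n: "0 < n"
    and \<kappa>: "\<And>x v. x \<in> sphere 0 1 \<Longrightarrow> x \<bullet> v = 0 \<Longrightarrow> tangent_energy x v = \<kappa> * (norm v)\<^sup>2"
    and "\<kappa> \<ge> 0"
  shows "a * (real (card M) - real n) \<le> A * (\<kappa> * (L / (2 * real n))\<^sup>2)"
proof -
  have curve: "arclength_sphere_curve \<gamma> L" and w0: "\<And>u. u \<in> {0..L} \<Longrightarrow> 0 \<le> w (\<gamma> u)"
    and wint: "(\<lambda>u. w (\<gamma> u)) integrable_on {0..L}"
    and lower: "\<And>f. poly_deg_le t f \<Longrightarrow> a * sphere_L2sq f \<le> integral {0..L} (\<lambda>u. (f (\<gamma> u))\<^sup>2 * w (\<gamma> u)) / L"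
    and upper: "\<And>f. poly_deg_le t f \<Longrightarrow> integral {0..L} (\<lambda>u. (f (\<gamma> u))\<^sup>2 * w (\<gamma> u)) / L \<le> A * sphere_L2sq f"
    using MZ by (auto simp: weighted_MZ_curve_def)
  have L: "0 < L" and cont: "continuous_on {0..L} \<gamma>"
    using curve by (auto simp: arclength_sphere_curve_def)
  define y where "y m \<alpha> = b \<alpha> (\<gamma> ((2 * real m + 1) * L / (2 * real n)))" for m :: nat and \<alpha>
  obtain P where P: "sym_idem M P" and kill: "\<And>m \<alpha>. m < n \<Longrightarrow> \<alpha> \<in> M \<Longrightarrow> (\<Sum>\<beta>\<in>M. P \<alpha> \<beta> * y m \<beta>) = 0"
    and tr: "real (card M) - real n \<le> (\<Sum>\<alpha>\<in>M. P \<alpha> \<alpha>)"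
    using sym_idem_killing[OF finite_reduced, of e t n y] by blast
  \<comment> \<open>The projection of \<open>b \<alpha>\<close>. By \<open>kill\<close> it vanishes
    at the midpoints, and its squared norm is the diagonal entry \<open>P \<alpha> \<alpha>\<close>,
    so that the squared norms add up to the trace.\<close>
  define f where "f \<alpha> x = (\<Sum>\<beta>\<in>M. P \<alpha> \<beta> * b \<beta> x)" for \<alpha> x
  have fdeg: "poly_deg_le t (f \<alpha>)" for \<alpha>
    unfolding f_def [abs_def] by (intro poly_deg_le_sum poly_deg_le_cmult b_deg_t)
  have int: "(\<lambda>u. (f \<alpha> (\<gamma> u))\<^sup>2 * w (\<gamma> u)) integrable_on {0..L}" for \<alpha>
    by (intro continuous_mult_integrable wint w0 continuous_intros
          continuous_on_compose2[OF is_poly_continuous_on[OF is_polyI[OF fdeg], of UNIV] cont]) auto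
  have "(\<Sum>\<alpha>\<in>M. sphere_L2sq (f \<alpha>)) = (\<Sum>\<alpha>\<in>M. P \<alpha> \<alpha>)"
  proof (intro sum.cong refl)
    fix \<alpha> assume \<alpha>: "\<alpha> \<in> M"
    have "sphere_L2sq (f \<alpha>) = (\<Sum>\<beta>\<in>M. (P \<alpha> \<beta>)\<^sup>2)"
      unfolding f_def [abs_def] by (rule sphere_L2sq_combination)
    also have "\<dots> = (\<Sum>\<beta>\<in>M. P \<alpha> \<beta> * P \<beta> \<alpha>)"
    proof (intro sum.cong refl)
      fix \<beta> assume "\<beta> \<in> M"
      then show "(P \<alpha> \<beta>)\<^sup>2 = P \<alpha> \<beta> * P \<beta> \<alpha>"
        using sym_idem_sym[OF P \<alpha>, of \<beta>] by (simp add: power2_eq_square)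
    qed
    also have "\<dots> = P \<alpha> \<alpha>" by (rule sym_idem_idem[OF P \<alpha> \<alpha>])
    finally show "sphere_L2sq (f \<alpha>) = P \<alpha> \<alpha>" .
  qed
  then have "a * (real (card M) - real n) \<le> a * (\<Sum>\<alpha>\<in>M. sphere_L2sq (f \<alpha>))"
    using tr \<open>0 < a\<close> by simp
  also have "\<dots> \<le> (\<Sum>\<alpha>\<in>M. integral {0..L} (\<lambda>u. (f \<alpha> (\<gamma> u))\<^sup>2 * w (\<gamma> u)) / L)"
    unfolding sum_distrib_left by (intro sum_mono lower fdeg)
  also have "\<dots> = integral {0..L} (\<lambda>u. \<Sum>\<alpha>\<in>M. (f \<alpha> (\<gamma> u))\<^sup>2 * w (\<gamma> u)) / L"
    by (simp add: integral_sum[OF finite_reduced int] flip: sum_divide_distrib)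
  also have "\<dots> \<le> integral {0..L} (\<lambda>u. \<kappa> * (L / (2 * real n))\<^sup>2 * w (\<gamma> u)) / L"
  proof (intro divide_right_mono integral_le)
    show "(\<lambda>u. \<Sum>\<alpha>\<in>M. (f \<alpha> (\<gamma> u))\<^sup>2 * w (\<gamma> u)) integrable_on {0..L}"
      by (intro integrable_sum finite_reduced int)
    show "(\<lambda>u. \<kappa> * (L / (2 * real n))\<^sup>2 * w (\<gamma> u)) integrable_on {0..L}"
      using wint by (rule integrable_on_mult_right)
    fix u assume u: "u \<in> {0..L}"
    then obtain m where m: "m < n" "\<bar>u - (2 * real m + 1) * L / (2 * real n)\<bar> \<le> L / (2 * real n)"
      using nearby_midpoint[OF L n, of u] by auto
    define p where "p = (2 * real m + 1) * L / (2 * real n)"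
    have "(2 * real m + 1) * L \<le> (2 * real n) * L" using m(1) L by (intro mult_right_mono) auto
    then have p: "0 \<le> p" "p \<le> L" using L n by (auto simp: p_def field_simps)
    \<comment> \<open>The values at the midpoint \<open>p\<close> may be subtracted because
      \<open>P\<close> kills them; the contraction then leaves the squared distance of two embedded
      points.\<close>
    have "(\<Sum>\<alpha>\<in>M. (f \<alpha> (\<gamma> u))\<^sup>2) = (\<Sum>\<alpha>\<in>M. (\<Sum>\<beta>\<in>M. P \<alpha> \<beta> * (b \<beta> (\<gamma> u) - b \<beta> (\<gamma> p)))\<^sup>2)"
      using kill[OF m(1)] by (simp add: f_def y_def p_def right_diff_distrib sum_subtractf)
    also have "\<dots> \<le> (\<Sum>\<beta>\<in>M. (b \<beta> (\<gamma> u) - b \<beta> (\<gamma> p))\<^sup>2)"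
      by (rule sym_idem_contraction[OF P])
    also have "\<dots> \<le> \<kappa> * (u - p)\<^sup>2"
    proof (cases "p \<le> u")
      case True
      then show ?thesis using u p by (intro curve_increment[OF curve \<kappa> \<open>\<kappa> \<ge> 0\<close>]) auto
    next
      case False
      then have "(\<Sum>\<beta>\<in>M. (b \<beta> (\<gamma> p) - b \<beta> (\<gamma> u))\<^sup>2) \<le> \<kappa> * (p - u)\<^sup>2"
        using u p by (intro curve_increment[OF curve \<kappa> \<open>\<kappa> \<ge> 0\<close>]) auto
      then show ?thesis by (simp only: power2_commute)
    qed
    also have "\<dots> \<le> \<kappa> * (L / (2 * real n))\<^sup>2"
    proof -
      have "(u - p)\<^sup>2 \<le> (L / (2 * real n))\<^sup>2"
        using m(2) L n by (subst abs_le_square_iff[symmetric]) (simp add: p_def)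
      then show ?thesis using \<open>\<kappa> \<ge> 0\<close> by (rule mult_left_mono)
    qed
    finally show "(\<Sum>\<alpha>\<in>M. (f \<alpha> (\<gamma> u))\<^sup>2 * w (\<gamma> u)) \<le> \<kappa> * (L / (2 * real n))\<^sup>2 * w (\<gamma> u)"
      using w0[OF u] unfolding sum_distrib_right[symmetric] by (rule mult_right_mono)
  qed (use L in auto)
  also have "\<dots> = \<kappa> * (L / (2 * real n))\<^sup>2 * (integral {0..L} (\<lambda>u. w (\<gamma> u)) / L)"
    by (simp only: integral_mult_right times_divide_eq_right)
  \<comment> \<open>The constant polynomial 1 has norm 1, so the upper inequality bounds the mean of
    the weight by \<open>A\<close>.\<close>
  also have "\<dots> \<le> \<kappa> * (L / (2 * real n))\<^sup>2 * A"
    using upper[OF poly_deg_le_const, of 1] \<open>\<kappa> \<ge> 0\<close> by (intro mult_left_mono) (auto simp: sphere_L2sq_one)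
  finally show ?thesis by (simp add: mult.commute)
qed

end

lemma length_bound_arith:
  fixes a A L d t :: real and N :: nat
  assumes "0 < a" "a \<le> A" "0 < L" "0 < t" "0 \<le> d" "d \<le> t" "2 \<le> N"
    and trace: "a * (real N - real (N div 2)) \<le> A * (real N * t * (t + d) / (d + 2) * (L / (2 * real (N div 2)))\<^sup>2)"
  shows "real N / t * (sqrt (d + 2) / 4) * (a / A) powr (1 + 1 / (2 * t)) \<le> L"
proof -
  define n where "n = real (N div 2)"
  define \<rho> where "\<rho> = a / A"
  have A: "0 < A" using assms by simp
  have \<rho>: "0 < \<rho>" "\<rho> \<le> 1" using assms A by (auto simp: \<rho>_def)
  have n: "real N - 1 \<le> 2 * n" "2 * n \<le> real N" "0 < n"
    using assms(7) unfolding n_def by linarith+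
  have "a * (real N / 2) \<le> a * (real N - n)" using n assms by (intro mult_left_mono) auto
  also have "\<dots> \<le> A * (real N * t * (t + d) / (d + 2) * (L / (2 * n))\<^sup>2)"
    using trace by (simp add: n_def)
  \<comment> \<open>This is where \<open>d \<le> t\<close> enters, replacing \<open>t + d\<close> by
    \<open>2 * t\<close>.\<close>
  also have "\<dots> \<le> A * (real N * t * (2 * t) / (d + 2) * (L / (2 * n))\<^sup>2)"
    using assms A by (intro mult_left_mono mult_right_mono divide_right_mono) auto
  also have "\<dots> = real N * (2 * A * t\<^sup>2 * L\<^sup>2 / ((d + 2) * (2 * n)\<^sup>2))"
    by (simp add: power2_eq_square)
  finally have "real N * (a / 2) \<le> real N * (2 * A * t\<^sup>2 * L\<^sup>2 / ((d + 2) * (2 * n)\<^sup>2))"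
    by (simp only: times_divide_eq_right mult.commute[of a])
  then have "a / 2 \<le> 2 * A * t\<^sup>2 * L\<^sup>2 / ((d + 2) * (2 * n)\<^sup>2)"
    using assms(7) by (subst (asm) mult_le_cancel_left_pos) auto
  moreover have "0 < (d + 2) * (2 * n)\<^sup>2" using n assms(5) by simp
  ultimately have "a / 2 * ((d + 2) * (2 * n)\<^sup>2) \<le> 2 * A * t\<^sup>2 * L\<^sup>2"
    by (simp only: pos_le_divide_eq)
  then have 1: "a * ((d + 2) * (2 * n)\<^sup>2) \<le> 4 * A * t\<^sup>2 * L\<^sup>2" by simp
  have "(real N / 2)\<^sup>2 \<le> (2 * n)\<^sup>2" using n assms(7) by (intro power_mono) auto
  then have "a * ((d + 2) * (real N / 2)\<^sup>2) \<le> a * ((d + 2) * (2 * n)\<^sup>2)"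
    using assms by (intro mult_left_mono) auto
  also note 1
  finally have "a * ((d + 2) * (real N / 2)\<^sup>2) \<le> L\<^sup>2 * (4 * A * t\<^sup>2)" by (simp only: mult.commute)
  moreover have "0 < 4 * A * t\<^sup>2" using A assms(4) by simp
  ultimately have "a * ((d + 2) * (real N / 2)\<^sup>2) / (4 * A * t\<^sup>2) \<le> L\<^sup>2"
    by (simp only: pos_divide_le_eq)
  also have "a * ((d + 2) * (real N / 2)\<^sup>2) / (4 * A * t\<^sup>2) = (real N)\<^sup>2 / t\<^sup>2 * ((d + 2) / 16) * \<rho>"
    by (simp add: \<rho>_def power_divide mult_ac)
  finally have 2: "(real N)\<^sup>2 / t\<^sup>2 * ((d + 2) / 16) * \<rho> \<le> L\<^sup>2" .
  \<comment> \<open>The trace yields exponent 1/2; as \<open>\<rho> \<le> 1\<close>, the larger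
    exponent only weakens the bound.\<close>
  have "(\<rho> powr (1 + 1 / (2 * t)))\<^sup>2 = \<rho> powr (2 * (1 + 1 / (2 * t)))"
    by (simp add: power2_eq_square flip: powr_add)
  also have "\<dots> \<le> \<rho> powr 1"
    using \<rho> assms(4) by (intro powr_mono') (auto intro: order.trans[of _ 2])
  finally have 3: "(\<rho> powr (1 + 1 / (2 * t)))\<^sup>2 \<le> \<rho>" using \<rho> by simp
  have "(real N / t * (sqrt (d + 2) / 4) * \<rho> powr (1 + 1 / (2 * t)))\<^sup>2 =
      (real N)\<^sup>2 / t\<^sup>2 * ((d + 2) / 16) * (\<rho> powr (1 + 1 / (2 * t)))\<^sup>2"
    using assms(5) by (simp add: power_mult_distrib power_divide)
  also have "\<dots> \<le> (real N)\<^sup>2 / t\<^sup>2 * ((d + 2) / 16) * \<rho>"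
    using 3 assms(5) by (intro mult_left_mono) auto
  also note 2
  finally show ?thesis unfolding \<rho>_def by (rule power2_le_imp_le) (use assms(3) in simp)
qed

theorem theorem5p2:
  fixes \<gamma> :: "real \<Rightarrow> 'a::euclidean_space" and w :: "'a \<Rightarrow> real"
    and L a A :: real and t :: nat
  assumes "DIM('a) \<ge> 3"
    and "t \<ge> DIM('a) - 1"
    and "0 < a" and "a \<le> A"
    and "weighted_MZ_curve t a A \<gamma> L w"
  shows "L \<ge> real (dim_Pi TYPE('a) t) / real t * (sqrt (real (DIM('a) - 1) + 2) / 4)
                * (a / A) powr (1 + 1 / (2 * real t))"
proof -
  obtain e :: 'a where e: "e \<in> Basis" using nonempty_Basis by blast
  obtain b where "sphere_basis e t b"
    by (rule orthonormal_basis_exists[OF e, of t]) (blast intro: sphere_basis.intro e)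
  then interpret sphere_basis e t b .
  define d where "d = DIM('a) - 1"
  have d: "DIM('a) = Suc d" "d > 0" "d \<le> t" "2 \<le> d" using assms by (auto simp: d_def)
  obtain s where s: "t = Suc s" using d by (cases t) auto
  have card: "card M = dim_Pi TYPE('a) t"
    using card_reduced_Suc[OF e d(1), of s] by (simp add: s dim_Pi_def d(1) Let_def)
  \<comment> \<open>Two dimensions make \<open>card M div 2\<close> positive, so the curve is cut
    into at least one arc.\<close>
  have "(d + t) choose t > 0" "(d + s) choose s > 0" by (simp_all add: zero_less_binomial)
  then have N2: "2 \<le> card M"
    using card_reduced_Suc[OF e d(1), of s] unfolding s by linarith
  let ?\<kappa> = "real (card M) * real t * (real t + real d) / (real d + 2)"
  have L: "0 < L" using assms by (simp add: weighted_MZ_curve_def arclength_sphere_curve_def)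
  have trace: "a * (real (card M) - real (card M div 2)) \<le> A * (?\<kappa> * (L / (2 * real (card M div 2)))\<^sup>2)"
    using N2 by (intro MZ_curve_trace[OF assms(5,3)] tangent_energy_eq[OF d(1,2)]) auto
  have "real (card M) / real t * (sqrt (real d + 2) / 4) * (a / A) powr (1 + 1 / (2 * real t)) \<le> L"
    by (rule length_bound_arith[OF assms(3,4) L _ _ _ N2 trace]) (use d in auto)
  then show ?thesis unfolding card d_def .
qed

end
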